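(* Let $B_T$ be a cluster-tilted algebra of type $A_n$ and let $M$ be an indecomposable $B_T$-module of shape $(k_1,\ldots,k_m)$. Let $s(M)$ denote the number of submodules of $M$ (including $0$ and $M$). Then $$s(M)=1+\sum_{j=0}^m \ \sum_{\substack{I\subseteq\{1,\ldots,m\},\ |I|=m-j,\\ I \text{ admissible}}}\ \prod_{i\in I}k_i ,$$ where the empty product equals $1$.
   Context: Let $\mathcal C$ be a (generalized) cluster category of Dynkin type $A_n$, i.e. a triangulated category triangle equivalent to the orbit category $D^b(kA_n)/\tau^{-1}[1]$. A cluster-tilting object is $T=\bigoplus_{i=1}^n T_i$ with $\operatorname{Ext}^1_{\mathcal C}(T,T)=0$ and the $T_i$ indecomposable and pairwise non-isomorphic; $B_T=\operatorname{End}_{\mathcal C}(T)=kQ/I$ is the associated cluster-tilted algebra of type $A_n$. Every indecomposable $B_T$-module is a string module in which every simple has multiplicity $0$ or $1$; so it is given by a string, i.e. a linear sequence of pairwise distinct vertices of $Q$ (its composition factors) in which neighbouring vertices are joined by an arrow. Shape. A simple composition factor of $M$ is called a valley if it belongs to $\operatorname{soc}(M)$ and a peak if it belongs to $M/\operatorname{rad}M$. Reading the string of $M$ from left to right, its peaks and valleys are numbered $S(1),S(2),\ldots,S(m+1)$ (they alternate; $S(1)$ and $S(m+1)$ are the two ends of the string). The $i$-th leg is the part of the string between $S(i)$ and $S(i+1)$, all arrows of which point in the same direction; $N_i$ is the uniserial submodule of $M$ consisting of all composition factors of this part except the peak, and $k_i$ is the composition length of $N_i$. Equivalently, $k_i$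 is the number of arrows in the $i$-th leg. Then $M$ is said to be of shape $(k_1,\ldots,k_m)$. For instance $1\leftarrow 2\rightarrow 3\rightarrow 4\rightarrow 5\leftarrow 6$ has shape $(1,3,1)$; a uniserial module of length $\ell$ has shape $(\ell-1)$ (in particular a simple module has shape $(0)$). Admissible sets. A subset $I=\{i_1<i_2<\cdots<i_l\}$ of $\{1,\ldots,m\}$ is called admissible if its gaps (integers strictly between consecutive elements of $I$ that are not in $I$) come in pairs $i,i+1$, that is, between any two consecutive elements $i_j<i_{j+1}$ of $I$ the number of missing integers is even; equivalently, consecutive elements of $I$ have opposite parity. The empty set and all singletons are admissible. For example, for $m=5$ the admissible sets are $12345$, $1234$, $2345$, $123$, $125$, $145$, $345$, $234$, $12$, $14$, $34$, $23$, $25$, $45$, $1$, $2$, $3$, $4$, $5$, $\emptyset$. *)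

theory Defs
  imports
    "HOL-Library.Poly_Mapping"
    "HOL-Library.Function_Algebras"
    "Graph_Theory.Arc_Walk"
begin

section \<open>Linear categories\<close>

text \<open>
  In a linear category all Hom-spaces are subspaces of one ambient vector space \<open>'h\<close>. Up to
  isomorphism this is no restriction: embed the Hom-spaces into their direct sum. They need not be
  disjoint, so composition (in the order \<open>g \<circ> f\<close>) and functors carry the objects as arguments:
  \<open>Comp C X Y Z g f\<close> is the composite of \<open>f : X \<rightarrow> Y\<close> and \<open>g : Y \<rightarrow> Z\<close>.
\<close>

record ('o, 'h, 'k) lincat =
  Ob :: "'o set"
  Hom :: "'o \<Rightarrow> 'o \<Rightarrow> 'h set"
  Id :: "'o \<Rightarrow> 'h"
  Comp :: "'o \<Rightarrow> 'o \<Rightarrow> 'o \<Rightarrow> 'h \<Rightarrow> 'h \<Rightarrow> 'h"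
  Scl :: "'k \<Rightarrow> 'h \<Rightarrow> 'h"

definition linear_category :: "('o, 'h::ab_group_add, 'k::field, 'z) lincat_scheme \<Rightarrow> bool" where
  "linear_category C \<longleftrightarrow>
     vector_space (Scl C) \<and>
     (\<forall>X\<in>Ob C. \<forall>Y\<in>Ob C. module.subspace (Scl C) (Hom C X Y)) \<and>
     (\<forall>X\<in>Ob C. Id C X \<in> Hom C X X) \<and>
     (\<forall>X\<in>Ob C. \<forall>Y\<in>Ob C. \<forall>f\<in>Hom C X Y.
        Comp C X X Y f (Id C X) = f \<and> Comp C X Y Y (Id C Y) f = f) \<and>
     (\<forall>X\<in>Ob C. \<forall>Y\<in>Ob C. \<forall>Z\<in>Ob C. \<forall>g\<in>Hom C Y Z. \<forall>f\<in>Hom C X Y.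
        Comp C X Y Z g f \<in> Hom C X Z) \<and>
     (\<forall>W\<in>Ob C. \<forall>X\<in>Ob C. \<forall>Y\<in>Ob C. \<forall>Z\<in>Ob C.
        \<forall>h\<in>Hom C Y Z. \<forall>g\<in>Hom C X Y. \<forall>f\<in>Hom C W X.
        Comp C W X Z (Comp C X Y Z h g) f = Comp C W Y Z h (Comp C W X Y g f)) \<and>
     (\<forall>X\<in>Ob C. \<forall>Y\<in>Ob C. \<forall>Z\<in>Ob C.
        \<forall>g\<in>Hom C Y Z. \<forall>g'\<in>Hom C Y Z. \<forall>f\<in>Hom C X Y. \<forall>f'\<in>Hom C X Y. \<forall>c.
        Comp C X Y Z (g + g') f = Comp C X Y Z g f + Comp C X Y Z g' f \<and>
        Comp C X Y Z g (f + f') = Comp C X Y Z g f + Comp C X Y Z g f' \<and>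
        Comp C X Y Z (Scl C c g) f = Scl C c (Comp C X Y Z g f) \<and>
        Comp C X Y Z g (Scl C c f) = Scl C c (Comp C X Y Z g f))"

definition iso_mor :: "('o, 'h, 'k, 'z) lincat_scheme \<Rightarrow> 'o \<Rightarrow> 'o \<Rightarrow> 'h \<Rightarrow> bool" where
  "iso_mor C X Y f \<longleftrightarrow> f \<in> Hom C X Y \<and>
     (\<exists>g\<in>Hom C Y X. Comp C X Y X g f = Id C X \<and> Comp C Y X Y f g = Id C Y)"

definition iso_ob :: "('o, 'h, 'k, 'z) lincat_scheme \<Rightarrow> 'o \<Rightarrow> 'o \<Rightarrow> bool" where
  "iso_ob C X Y \<longleftrightarrow> (\<exists>f. iso_mor C X Y f)"

definition zero_ob :: "('o, 'h::zero, 'k, 'z) lincat_scheme \<Rightarrow> 'o \<Rightarrow> bool" where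
  "zero_ob C X \<longleftrightarrow> X \<in> Ob C \<and> Id C X = 0"

definition is_biproduct ::
  "('o, 'h::ab_group_add, 'k, 'z) lincat_scheme \<Rightarrow> 'i set \<Rightarrow> ('i \<Rightarrow> 'o) \<Rightarrow> 'o
     \<Rightarrow> ('i \<Rightarrow> 'h) \<Rightarrow> ('i \<Rightarrow> 'h) \<Rightarrow> bool" where
  "is_biproduct C J X Z inc prj \<longleftrightarrow> Z \<in> Ob C \<and>
     (\<forall>i\<in>J. X i \<in> Ob C \<and> inc i \<in> Hom C (X i) Z \<and> prj i \<in> Hom C Z (X i)) \<and>
     (\<forall>i\<in>J. \<forall>j\<in>J. Comp C (X i) Z (X j) (prj j) (inc i) = (if i = j then Id C (X i) else 0)) \<and>
     (\<Sum>i\<in>J. Comp C Z (X i) Z (inc i) (prj i)) = Id C Z"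

definition is_biproduct2 ::
  "('o, 'h::ab_group_add, 'k, 'z) lincat_scheme \<Rightarrow> 'o \<Rightarrow> 'o \<Rightarrow> 'o
     \<Rightarrow> 'h \<Rightarrow> 'h \<Rightarrow> 'h \<Rightarrow> 'h \<Rightarrow> bool" where
  "is_biproduct2 C X Y Z i1 i2 p1 p2 \<longleftrightarrow>
     is_biproduct C UNIV (\<lambda>b. if b then X else Y) Z
       (\<lambda>b. if b then i1 else i2) (\<lambda>b. if b then p1 else p2)"

definition indecomposable_ob :: "('o, 'h::ab_group_add, 'k, 'z) lincat_scheme \<Rightarrow> 'o \<Rightarrow> bool" where
  "indecomposable_ob C X \<longleftrightarrow> X \<in> Ob C \<and> \<not> zero_ob C X \<and>
     (\<forall>A\<in>Ob C. \<forall>B\<in>Ob C. \<forall>i1 i2 p1 p2.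
        is_biproduct2 C A B X i1 i2 p1 p2 \<longrightarrow> zero_ob C A \<or> zero_ob C B)"

record ('o, 'h, 'p, 'g) lfun =
  fob :: "'o \<Rightarrow> 'p"
  fmor :: "'o \<Rightarrow> 'o \<Rightarrow> 'h \<Rightarrow> 'g"

definition linear_functor ::
  "('o, 'h::ab_group_add, 'k, 'z) lincat_scheme \<Rightarrow> ('p, 'g::ab_group_add, 'k, 'y) lincat_scheme
     \<Rightarrow> ('o, 'h, 'p, 'g) lfun \<Rightarrow> bool" where
  "linear_functor C D F \<longleftrightarrow>
     (\<forall>X\<in>Ob C. fob F X \<in> Ob D \<and> fmor F X X (Id C X) = Id D (fob F X)) \<and>
     (\<forall>X\<in>Ob C. \<forall>Y\<in>Ob C. \<forall>f\<in>Hom C X Y. \<forall>f'\<in>Hom C X Y. \<forall>c.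
        fmor F X Y f \<in> Hom D (fob F X) (fob F Y) \<and>
        fmor F X Y (f + f') = fmor F X Y f + fmor F X Y f' \<and>
        fmor F X Y (Scl C c f) = Scl D c (fmor F X Y f)) \<and>
     (\<forall>X\<in>Ob C. \<forall>Y\<in>Ob C. \<forall>Z\<in>Ob C. \<forall>g\<in>Hom C Y Z. \<forall>f\<in>Hom C X Y.
        fmor F X Z (Comp C X Y Z g f) =
        Comp D (fob F X) (fob F Y) (fob F Z) (fmor F Y Z g) (fmor F X Y f))"

definition comp_fun :: "('p, 'g, 'q, 'i) lfun \<Rightarrow> ('o, 'h, 'p, 'g) lfun \<Rightarrow> ('o, 'h, 'q, 'i) lfun" where
  "comp_fun G F = \<lparr> fob = (\<lambda>X. fob G (fob F X)),
     fmor = (\<lambda>X Y f. fmor G (fob F X) (fob F Y) (fmor F X Y f)) \<rparr>"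

definition nat_iso ::
  "('o, 'h, 'k, 'z) lincat_scheme \<Rightarrow> ('p, 'g, 'k, 'y) lincat_scheme
     \<Rightarrow> ('o, 'h, 'p, 'g) lfun \<Rightarrow> ('o, 'h, 'p, 'g) lfun \<Rightarrow> ('o \<Rightarrow> 'g) \<Rightarrow> bool" where
  "nat_iso C D F G \<eta> \<longleftrightarrow>
     (\<forall>X\<in>Ob C. iso_mor D (fob F X) (fob G X) (\<eta> X)) \<and>
     (\<forall>X\<in>Ob C. \<forall>Y\<in>Ob C. \<forall>f\<in>Hom C X Y.
        Comp D (fob F X) (fob F Y) (fob G Y) (\<eta> Y) (fmor F X Y f) =
        Comp D (fob F X) (fob G X) (fob G Y) (fmor G X Y f) (\<eta> X))"

definition linear_equivalence ::
  "('o, 'h::ab_group_add, 'k, 'z) lincat_scheme \<Rightarrow> ('p, 'g::ab_group_add, 'k, 'y) lincat_scheme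
     \<Rightarrow> ('o, 'h, 'p, 'g) lfun \<Rightarrow> bool" where
  "linear_equivalence C D F \<longleftrightarrow> linear_functor C D F \<and>
     (\<forall>X\<in>Ob C. \<forall>Y\<in>Ob C. bij_betw (fmor F X Y) (Hom C X Y) (Hom D (fob F X) (fob F Y))) \<and>
     (\<forall>Z\<in>Ob D. \<exists>X\<in>Ob C. iso_ob D (fob F X) Z)"


section \<open>Triangulated categories\<close>

text \<open>A triangle \<open>(X, Y, Z, f, g, h)\<close> is \<open>X \<rightarrow> Y \<rightarrow> Z \<rightarrow> \<Sigma> X\<close> with maps \<open>f\<close>, \<open>g\<close>, \<open>h\<close>.\<close>

type_synonym ('o, 'h) triangle = "'o \<times> 'o \<times> 'o \<times> 'h \<times> 'h \<times> 'h"

record ('o, 'h, 'k) tricat = "('o, 'h, 'k) lincat" +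
  Sus :: "('o, 'h, 'o, 'h) lfun"
  Tri :: "('o, 'h) triangle set"

abbreviation susp :: "('o, 'h, 'k, 'z) tricat_scheme \<Rightarrow> 'o \<Rightarrow> 'o" where
  "susp C X \<equiv> fob (Sus C) X"

fun is_triangle :: "('o, 'h, 'k, 'z) tricat_scheme \<Rightarrow> ('o, 'h) triangle \<Rightarrow> bool" where
  "is_triangle C (X, Y, Z, f, g, h) \<longleftrightarrow> X \<in> Ob C \<and> Y \<in> Ob C \<and> Z \<in> Ob C \<and>
     f \<in> Hom C X Y \<and> g \<in> Hom C Y Z \<and> h \<in> Hom C Z (susp C X)"

fun triangle_iso ::
  "('o, 'h, 'k, 'z) tricat_scheme \<Rightarrow> ('o, 'h) triangle \<Rightarrow> ('o, 'h) triangle \<Rightarrow> bool" where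
  "triangle_iso C (X, Y, Z, f, g, h) (X', Y', Z', f', g', h') \<longleftrightarrow>
     is_triangle C (X, Y, Z, f, g, h) \<and> is_triangle C (X', Y', Z', f', g', h') \<and>
     (\<exists>a b c. iso_mor C X X' a \<and> iso_mor C Y Y' b \<and> iso_mor C Z Z' c \<and>
        Comp C X Y Y' b f = Comp C X X' Y' f' a \<and>
        Comp C Y Z Z' c g = Comp C Y Y' Z' g' b \<and>
        Comp C Z (susp C X) (susp C X') (fmor (Sus C) X X' a) h =
        Comp C Z Z' (susp C X') h' c)"

text \<open>The last two conjuncts are the completion axiom for morphisms and the octahedral axiom.\<close>

definition triangulated_category ::
  "('o, 'h::ab_group_add, 'k::field, 'z) tricat_scheme \<Rightarrow> bool" where
  "triangulated_category C \<longleftrightarrow>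
     linear_category C \<and> (\<exists>X. zero_ob C X) \<and>
     (\<forall>X\<in>Ob C. \<forall>Y\<in>Ob C. \<exists>Z i1 i2 p1 p2. is_biproduct2 C X Y Z i1 i2 p1 p2) \<and>
     linear_equivalence C C (Sus C) \<and>
     (\<forall>t\<in>Tri C. is_triangle C t) \<and>
     (\<forall>t\<in>Tri C. \<forall>t'. triangle_iso C t t' \<longrightarrow> t' \<in> Tri C) \<and>
     (\<forall>X\<in>Ob C. \<forall>W. zero_ob C W \<longrightarrow> (X, X, W, Id C X, 0, 0) \<in> Tri C) \<and>
     (\<forall>X\<in>Ob C. \<forall>Y\<in>Ob C. \<forall>f\<in>Hom C X Y. \<exists>Z g h. (X, Y, Z, f, g, h) \<in> Tri C) \<and>
     (\<forall>X Y Z f g h. is_triangle C (X, Y, Z, f, g, h) \<longrightarrow>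
        ((X, Y, Z, f, g, h) \<in> Tri C \<longleftrightarrow>
         (Y, Z, susp C X, g, h, - fmor (Sus C) X Y f) \<in> Tri C)) \<and>
     (\<forall>X Y Z f g h X' Y' Z' f' g' h'. \<forall>a\<in>Hom C X X'. \<forall>b\<in>Hom C Y Y'.
        (X, Y, Z, f, g, h) \<in> Tri C \<and> (X', Y', Z', f', g', h') \<in> Tri C \<and>
        Comp C X Y Y' b f = Comp C X X' Y' f' a \<longrightarrow>
        (\<exists>c\<in>Hom C Z Z'. Comp C Y Z Z' c g = Comp C Y Y' Z' g' b \<and>
           Comp C Z (susp C X) (susp C X') (fmor (Sus C) X X' a) h =
           Comp C Z Z' (susp C X') h' c)) \<and>
     (\<forall>X Y Z X' Y' Z' f g i i' j j' k k'.
        (X, Y, Z', f, i, i') \<in> Tri C \<and> (Y, Z, X', g, j, j') \<in> Tri C \<and>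
        (X, Z, Y', Comp C X Y Z g f, k, k') \<in> Tri C \<longrightarrow>
        (\<exists>u\<in>Hom C Z' Y'. \<exists>v\<in>Hom C Y' X'.
           (Z', Y', X', u, v,
              Comp C X' (susp C Y) (susp C Z') (fmor (Sus C) Y Z' i) j') \<in> Tri C \<and>
           Comp C Y Z' Y' u i = Comp C Y Z Y' k g \<and>
           Comp C Z' Y' (susp C X) k' u = i' \<and>
           Comp C Z Y' X' v k = j \<and>
           Comp C Y' X' (susp C Y) j' v =
           Comp C Y' (susp C X) (susp C Y) (fmor (Sus C) X Y f) k'))"

definition triangle_functor ::
  "('o, 'h::ab_group_add, 'k, 'z) tricat_scheme \<Rightarrow> ('p, 'g::ab_group_add, 'k, 'y) tricat_scheme
     \<Rightarrow> ('o, 'h, 'p, 'g) lfun \<Rightarrow> bool" where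
  "triangle_functor C D G \<longleftrightarrow> linear_functor C D G \<and>
     (\<exists>\<phi>. nat_iso C D (comp_fun G (Sus C)) (comp_fun (Sus D) G) \<phi> \<and>
        (\<forall>X Y Z f g h. (X, Y, Z, f, g, h) \<in> Tri C \<longrightarrow>
           (fob G X, fob G Y, fob G Z, fmor G X Y f, fmor G Y Z g,
            Comp D (fob G Z) (fob G (susp C X)) (susp D (fob G X))
              (\<phi> X) (fmor G Z (susp C X) h)) \<in> Tri D))"


section \<open>Finite-dimensional representations of the linearly oriented quiver of type A\<close>

text \<open>
  Representations of \<open>1 \<rightarrow> 2 \<rightarrow> \<cdots> \<rightarrow> n\<close> over \<open>'k\<close> on coordinate spaces. A matrix is a function of
  a row and a column index which vanishes outside its format, so that families of matrices form an
  abelian group; indices start at 0.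
\<close>

type_synonym 'k matrix = "nat \<Rightarrow> nat \<Rightarrow> 'k"

definition mats :: "nat \<Rightarrow> nat \<Rightarrow> ('k::zero) matrix set" where
  "mats r c = {A. \<forall>a b. a \<ge> r \<or> b \<ge> c \<longrightarrow> A a b = 0}"

definition mat_mult :: "nat \<Rightarrow> ('k::semiring_0) matrix \<Rightarrow> 'k matrix \<Rightarrow> 'k matrix" where
  "mat_mult d A B = (\<lambda>a c. \<Sum>b<d. A a b * B b c)"

definition vecs :: "nat \<Rightarrow> (nat \<Rightarrow> 'k::zero) set" where
  "vecs d = {x. \<forall>b\<ge>d. x b = 0}"

definition mat_vec :: "nat \<Rightarrow> ('k::semiring_0) matrix \<Rightarrow> (nat \<Rightarrow> 'k) \<Rightarrow> nat \<Rightarrow> 'k" where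
  "mat_vec d A x = (\<lambda>a. \<Sum>b<d. A a b * x b)"

text \<open>\<open>rmap V i\<close> is the action of the arrow \<open>i \<rightarrow> i + 1\<close>.\<close>

record 'k rep =
  rdim :: "nat \<Rightarrow> nat"
  rmap :: "nat \<Rightarrow> 'k matrix"

definition mod_An :: "nat \<Rightarrow> ('k rep, nat \<Rightarrow> 'k matrix, 'k::field) lincat" where
  "mod_An n = \<lparr>
     Ob = {V. (\<forall>i. i \<notin> {1..n} \<longrightarrow> rdim V i = 0) \<and>
              (\<forall>i. rmap V i \<in> mats (rdim V (i + 1)) (rdim V i))},
     Hom = (\<lambda>V W. {f. (\<forall>i. f i \<in> mats (rdim W i) (rdim V i)) \<and>
              (\<forall>i\<in>{1..<n}. mat_mult (rdim W i) (rmap W i) (f i) =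
                           mat_mult (rdim V (i + 1)) (f (i + 1)) (rmap V i))}),
     Id = (\<lambda>V i a b. if a = b \<and> a < rdim V i then 1 else 0),
     Comp = (\<lambda>U V W g f i. mat_mult (rdim V i) (g i) (f i)),
     Scl = (\<lambda>c f i a b. c * f i a b) \<rparr>"


section \<open>Bounded complexes and the bounded derived category\<close>

text \<open>Cohomological grading: \<open>cdf X p\<close> goes from degree \<open>p\<close> to degree \<open>p + 1\<close>.\<close>

record ('o, 'h) cpx =
  cob :: "int \<Rightarrow> 'o"
  cdf :: "int \<Rightarrow> 'h"

definition Chb :: "('o, 'h::ab_group_add, 'k) lincat \<Rightarrow> (('o, 'h) cpx, int \<Rightarrow> 'h, 'k) lincat" where
  "Chb A = \<lparr>
     Ob = {X. (\<forall>p. cob X p \<in> Ob A \<and> cdf X p \<in> Hom A (cob X p) (cob X (p + 1)) \<and>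
                   Comp A (cob X p) (cob X (p + 1)) (cob X (p + 2)) (cdf X (p + 1)) (cdf X p) = 0) \<and>
              finite {p. \<not> zero_ob A (cob X p)}},
     Hom = (\<lambda>X Y. {f. \<forall>p. f p \<in> Hom A (cob X p) (cob Y p) \<and>
              Comp A (cob X p) (cob Y p) (cob Y (p + 1)) (cdf Y p) (f p) =
              Comp A (cob X p) (cob X (p + 1)) (cob Y (p + 1)) (f (p + 1)) (cdf X p)}),
     Id = (\<lambda>X p. Id A (cob X p)),
     Comp = (\<lambda>X Y Z g f p. Comp A (cob X p) (cob Y p) (cob Z p) (g p) (f p)),
     Scl = (\<lambda>c f p. Scl A c (f p)) \<rparr>"

definition shift :: "(('o, 'h::ab_group_add) cpx, int \<Rightarrow> 'h, ('o, 'h) cpx, int \<Rightarrow> 'h) lfun" where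
  "shift = \<lparr> fob = (\<lambda>X. \<lparr> cob = (\<lambda>p. cob X (p + 1)), cdf = (\<lambda>p. - cdf X (p + 1)) \<rparr>),
             fmor = (\<lambda>X Y f p. f (p + 1)) \<rparr>"

definition null_homotopic ::
  "('o, 'h::ab_group_add, 'k) lincat \<Rightarrow> ('o, 'h) cpx \<Rightarrow> ('o, 'h) cpx \<Rightarrow> (int \<Rightarrow> 'h) \<Rightarrow> bool" where
  "null_homotopic A X Y f \<longleftrightarrow>
     (\<exists>s. \<forall>p. s p \<in> Hom A (cob X p) (cob Y (p - 1)) \<and>
        f p = Comp A (cob X p) (cob Y (p - 1)) (cob Y p) (cdf Y (p - 1)) (s p) +
              Comp A (cob X p) (cob X (p + 1)) (cob Y p) (s (p + 1)) (cdf X p))"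

text \<open>
  \<open>Z\<close> is a mapping cone of \<open>f : X \<rightarrow> Y\<close>: in degree \<open>p\<close> it is \<open>X\<^sup>p\<^sup>+\<^sup>1 \<oplus> Y\<^sup>p\<close>, with differential
  \<open>(x, y) \<mapsto> (- d x, f x + d y)\<close>; \<open>i : Y \<rightarrow> Z\<close> and \<open>r : Z \<rightarrow> X[1]\<close> are the canonical maps.
\<close>

definition is_cone ::
  "('o, 'h::ab_group_add, 'k) lincat \<Rightarrow> ('o, 'h) cpx \<Rightarrow> ('o, 'h) cpx \<Rightarrow> (int \<Rightarrow> 'h)
     \<Rightarrow> ('o, 'h) cpx \<Rightarrow> (int \<Rightarrow> 'h) \<Rightarrow> (int \<Rightarrow> 'h) \<Rightarrow> bool" where
  "is_cone A X Y f Z i r \<longleftrightarrow> Z \<in> Ob (Chb A) \<and>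
     (\<exists>i' r'. \<forall>p.
        is_biproduct2 A (cob X (p + 1)) (cob Y p) (cob Z p) (i' p) (i p) (r p) (r' p) \<and>
        cdf Z p =
          Comp A (cob Z p) (cob X (p + 1)) (cob Z (p + 1))
            (Comp A (cob X (p + 1)) (cob X (p + 2)) (cob Z (p + 1)) (i' (p + 1)) (- cdf X (p + 1)))
            (r p) +
          Comp A (cob Z p) (cob X (p + 1)) (cob Z (p + 1))
            (Comp A (cob X (p + 1)) (cob Y (p + 1)) (cob Z (p + 1)) (i (p + 1)) (f (p + 1)))
            (r p) +
          Comp A (cob Z p) (cob Y p) (cob Z (p + 1))
            (Comp A (cob Y p) (cob Y (p + 1)) (cob Z (p + 1)) (i (p + 1)) (cdf Y p))
            (r' p))"

type_synonym 'k rep_cpx = "('k rep, nat \<Rightarrow> 'k matrix) cpx"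
type_synonym 'k rep_cpx_mor = "int \<Rightarrow> nat \<Rightarrow> 'k matrix"

definition cocycles :: "('k::field) rep_cpx \<Rightarrow> int \<Rightarrow> nat \<Rightarrow> (nat \<Rightarrow> 'k) set" where
  "cocycles X p i = {x \<in> vecs (rdim (cob X p) i). mat_vec (rdim (cob X p) i) (cdf X p i) x = 0}"

definition coboundaries :: "('k::field) rep_cpx \<Rightarrow> int \<Rightarrow> nat \<Rightarrow> (nat \<Rightarrow> 'k) set" where
  "coboundaries X p i =
     mat_vec (rdim (cob X (p - 1)) i) (cdf X (p - 1) i) ` vecs (rdim (cob X (p - 1)) i)"

text \<open>The two conjuncts: surjectivity and injectivity of \<open>H\<^sup>p(f)\<close> at the vertex \<open>i\<close>.\<close>

definition quasi_iso ::
  "nat \<Rightarrow> ('k::field) rep_cpx \<Rightarrow> 'k rep_cpx \<Rightarrow> 'k rep_cpx_mor \<Rightarrow> bool" where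
  "quasi_iso n X Y f \<longleftrightarrow> f \<in> Hom (Chb (mod_An n)) X Y \<and>
     (\<forall>p. \<forall>i\<in>{1..n}.
        (\<forall>y\<in>cocycles Y p i. \<exists>x\<in>cocycles X p i.
           y - mat_vec (rdim (cob X p) i) (f p i) x \<in> coboundaries Y p i) \<and>
        (\<forall>x\<in>cocycles X p i. mat_vec (rdim (cob X p) i) (f p i) x \<in> coboundaries Y p i \<longrightarrow>
           x \<in> coboundaries X p i))"

text \<open>
  \<open>q : Chb(mod kA\<^sub>n) \<rightarrow> D\<close> is the localisation of the homotopy category at the quasi-isomorphisms
  (calculus of fractions: every morphism is a fraction \<open>q f \<circ> (q s)\<^sup>-\<^sup>1\<close>, and \<open>q\<close> identifies two chain
  maps iff they become homotopic after composing with a quasi-isomorphism), the suspension of \<open>D\<close>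
  extends the shift of complexes, and the distinguished triangles of \<open>D\<close> are those isomorphic to
  the images of mapping cone triangles.
\<close>

definition bounded_derived_category ::
  "nat \<Rightarrow> ('d, 'e::ab_group_add, 'k::field) tricat
     \<Rightarrow> ('k rep_cpx, 'k rep_cpx_mor, 'd, 'e) lfun \<Rightarrow> bool" where
  "bounded_derived_category n D q \<longleftrightarrow>
     (let A = mod_An n; K = Chb A in
      linear_category D \<and> linear_functor K D q \<and> linear_functor D D (Sus D) \<and>
      (\<forall>Z\<in>Ob D. \<exists>X\<in>Ob K. iso_ob D (fob q X) Z) \<and>
      (\<forall>X\<in>Ob K. \<forall>Y\<in>Ob K. \<forall>s. quasi_iso n X Y s \<longrightarrow>
         iso_mor D (fob q X) (fob q Y) (fmor q X Y s)) \<and>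
      (\<forall>X\<in>Ob K. \<forall>Y\<in>Ob K. \<forall>h\<in>Hom D (fob q X) (fob q Y).
         \<exists>X'\<in>Ob K. \<exists>s. \<exists>f\<in>Hom K X' Y. quasi_iso n X' X s \<and>
           Comp D (fob q X') (fob q X) (fob q Y) h (fmor q X' X s) = fmor q X' Y f) \<and>
      (\<forall>X\<in>Ob K. \<forall>Y\<in>Ob K. \<forall>f\<in>Hom K X Y. \<forall>g\<in>Hom K X Y.
         fmor q X Y f = fmor q X Y g \<longleftrightarrow>
         (\<exists>X'\<in>Ob K. \<exists>s. quasi_iso n X' X s \<and>
            null_homotopic A X' Y (Comp K X' X Y f s - Comp K X' X Y g s))) \<and>
      (\<exists>\<theta>. nat_iso K D (comp_fun q shift) (comp_fun (Sus D) q) \<theta> \<and>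
         Tri D = {t. \<exists>X\<in>Ob K. \<exists>Y\<in>Ob K. \<exists>f\<in>Hom K X Y. \<exists>Z i r. is_cone A X Y f Z i r \<and>
           triangle_iso D
             (fob q X, fob q Y, fob q Z, fmor q X Y f, fmor q Y Z i,
              Comp D (fob q Z) (fob q (fob shift X)) (susp D (fob q X))
                (\<theta> X) (fmor q Z (fob shift X) r)) t}))"


section \<open>The cluster category\<close>

definition linear_form_on :: "('k \<Rightarrow> 'h \<Rightarrow> 'h) \<Rightarrow> 'h set \<Rightarrow> ('h::ab_group_add \<Rightarrow> 'k::field) \<Rightarrow> bool" where
  "linear_form_on scl V \<phi> \<longleftrightarrow>
     (\<forall>f\<in>V. \<forall>g\<in>V. \<phi> (f + g) = \<phi> f + \<phi> g) \<and> (\<forall>c. \<forall>f\<in>V. \<phi> (scl c f) = c * \<phi> f)"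

text \<open>
  The Auslander-Reiten translation is determined by \<open>Hom(Y, \<Sigma> \<tau> X) \<cong> Hom(X, Y)\<^sup>*\<close>, naturally in \<open>X\<close>
  and \<open>Y\<close>; \<open>\<Sigma> \<tau>\<close> is thus a Serre functor. By the Yoneda lemma such an isomorphism has the form
  \<open>g \<mapsto> (f \<mapsto> tr X (g \<circ> f))\<close> for linear forms \<open>tr X\<close> on \<open>Hom(X, \<Sigma> \<tau> X)\<close>, which makes it natural in
  \<open>Y\<close>; the last conjunct is naturality in \<open>X\<close>.
\<close>

definition AR_translation ::
  "('d, 'e::ab_group_add, 'k::field) tricat \<Rightarrow> ('d, 'e, 'd, 'e) lfun \<Rightarrow> bool" where
  "AR_translation D \<tau> \<longleftrightarrow> linear_equivalence D D \<tau> \<and>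
     (let S = comp_fun (Sus D) \<tau> in
      \<exists>tr. (\<forall>X\<in>Ob D. linear_form_on (Scl D) (Hom D X (fob S X)) (tr X)) \<and>
        (\<forall>X\<in>Ob D. \<forall>Y\<in>Ob D. \<forall>\<phi>. linear_form_on (Scl D) (Hom D X Y) \<phi> \<longrightarrow>
           (\<exists>!g. g \<in> Hom D Y (fob S X) \<and>
                 (\<forall>f\<in>Hom D X Y. \<phi> f = tr X (Comp D X Y (fob S X) g f)))) \<and>
        (\<forall>X\<in>Ob D. \<forall>X'\<in>Ob D. \<forall>u\<in>Hom D X X'. \<forall>h\<in>Hom D X' (fob S X).
           tr X (Comp D X X' (fob S X) h u) =
           tr X' (Comp D X' (fob S X) (fob S X') (fmor S X X' u) h)))"

text \<open>
  An automorphism of \<open>D\<close> together with all its integral powers: \<open>F i\<close> is the \<open>i\<close>-th power of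
  \<open>F 1\<close>. Every autoequivalence becomes an automorphism after passing to a skeleton of \<open>D\<close>.
\<close>

definition automorphism_powers ::
  "('d, 'e::ab_group_add, 'k, 'z) lincat_scheme \<Rightarrow> (int \<Rightarrow> ('d, 'e, 'd, 'e) lfun) \<Rightarrow> bool" where
  "automorphism_powers D F \<longleftrightarrow>
     (\<forall>i. linear_functor D D (F i)) \<and>
     (\<forall>X\<in>Ob D. fob (F 0) X = X \<and> (\<forall>i j. fob (F (i + j)) X = fob (F i) (fob (F j) X))) \<and>
     (\<forall>X\<in>Ob D. \<forall>Y\<in>Ob D. \<forall>f\<in>Hom D X Y. fmor (F 0) X Y f = f \<and>
        (\<forall>i j. fmor (F (i + j)) X Y f =
               fmor (F i) (fob (F j) X) (fob (F j) Y) (fmor (F j) X Y f)))"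

text \<open>
  The orbit category \<open>D/F\<close>: \<open>Hom(X, Y) = \<Oplus>\<^sub>i Hom\<^sub>D(X, F\<^sup>i Y)\<close>, and the component in degree \<open>i + j\<close>
  of the composite of \<open>f : X \<rightarrow> F\<^sup>i Y\<close> and \<open>g : Y \<rightarrow> F\<^sup>j Z\<close> is \<open>F\<^sup>i g \<circ> f\<close>.
\<close>

definition orbit_category ::
  "('d, 'e::ab_group_add, 'k, 'z) lincat_scheme \<Rightarrow> (int \<Rightarrow> ('d, 'e, 'd, 'e) lfun)
     \<Rightarrow> ('d, int \<Rightarrow>\<^sub>0 'e, 'k) lincat" where
  "orbit_category D F = \<lparr>
     Ob = Ob D,
     Hom = (\<lambda>X Y. {f. \<forall>i. Poly_Mapping.lookup f i \<in> Hom D X (fob (F i) Y)}),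
     Id = (\<lambda>X. Poly_Mapping.single 0 (Id D X)),
     Comp = (\<lambda>X Y Z g f. \<Sum>i\<in>Poly_Mapping.keys f. \<Sum>j\<in>Poly_Mapping.keys g.
        Poly_Mapping.single (i + j)
          (Comp D X (fob (F i) Y) (fob (F (i + j)) Z)
             (fmor (F i) Y (fob (F j) Z) (Poly_Mapping.lookup g j)) (Poly_Mapping.lookup f i))),
     Scl = (\<lambda>c. Poly_Mapping.map (Scl D c)) \<rparr>"

definition orbit_projection :: "('d, 'e::zero, 'd, int \<Rightarrow>\<^sub>0 'e) lfun" where
  "orbit_projection = \<lparr> fob = (\<lambda>X. X), fmor = (\<lambda>X Y f. Poly_Mapping.single 0 f) \<rparr>"

text \<open>
  \<open>C\<close> is a triangulated category equivalent to the orbit category of \<open>D = D\<^sup>b(kA\<^sub>n)\<close> under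
  \<open>F = \<tau>\<^sup>-\<^sup>1[1]\<close>, expressed by \<open>\<tau> \<circ> F \<cong> [1]\<close>. The triangulated structure of the orbit category makes
  the projection from \<open>D\<close> a triangle functor; compatibility of the equivalence \<open>E\<close> with the
  triangulated structures is expressed by that property of the composite \<open>D \<rightarrow> D/F \<rightarrow> C\<close>.
\<close>

definition cluster_category_An ::
  "nat \<Rightarrow> ('o, 'h::ab_group_add, 'k::field) tricat
     \<Rightarrow> ('d, 'e::ab_group_add, 'k) tricat
     \<Rightarrow> ('k rep_cpx, 'k rep_cpx_mor, 'd, 'e) lfun
     \<Rightarrow> ('d, 'e, 'd, 'e) lfun \<Rightarrow> (int \<Rightarrow> ('d, 'e, 'd, 'e) lfun)
     \<Rightarrow> ('d, int \<Rightarrow>\<^sub>0 'e, 'o, 'h) lfun \<Rightarrow> bool" where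
  "cluster_category_An n C D q \<tau> F E \<longleftrightarrow>
     triangulated_category C \<and>
     bounded_derived_category n D q \<and>
     AR_translation D \<tau> \<and>
     automorphism_powers D F \<and>
     (\<exists>\<psi>. nat_iso D D (comp_fun \<tau> (F 1)) (Sus D) \<psi>) \<and>
     linear_equivalence (orbit_category D F) C E \<and>
     triangle_functor D C (comp_fun E orbit_projection)"

text \<open>\<open>T = T\<^sub>1 \<oplus> \<cdots> \<oplus> T\<^sub>n\<close>, and \<open>Ext\<^sup>1(T, T) = Hom(T, \<Sigma> T) = 0\<close>.\<close>

definition cluster_tilting_object ::
  "nat \<Rightarrow> ('o, 'h::ab_group_add, 'k, 'z) tricat_scheme \<Rightarrow> 'o \<Rightarrow> (nat \<Rightarrow> 'o)
     \<Rightarrow> (nat \<Rightarrow> 'h) \<Rightarrow> (nat \<Rightarrow> 'h) \<Rightarrow> bool" where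
  "cluster_tilting_object n C T Ts inc prj \<longleftrightarrow>
     is_biproduct C {1..n} Ts T inc prj \<and>
     (\<forall>i\<in>{1..n}. indecomposable_ob C (Ts i)) \<and>
     (\<forall>i\<in>{1..n}. \<forall>j\<in>{1..n}. i \<noteq> j \<longrightarrow> \<not> iso_ob C (Ts i) (Ts j)) \<and>
     Hom C T (susp C T) = {0}"


section \<open>Bound quiver algebras\<close>

record ('b, 'k) kalg =
  acar :: "'b set"
  aone :: "'b"
  amul :: "'b \<Rightarrow> 'b \<Rightarrow> 'b"
  ascl :: "'k \<Rightarrow> 'b \<Rightarrow> 'b"

definition End_alg :: "('o, 'h, 'k, 'z) lincat_scheme \<Rightarrow> 'o \<Rightarrow> ('h, 'k) kalg" where
  "End_alg C T = \<lparr> acar = Hom C T T, aone = Id C T, amul = Comp C T T T, ascl = Scl C \<rparr>"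

definition summand_idempotent ::
  "('o, 'h, 'k, 'z) lincat_scheme \<Rightarrow> 'o \<Rightarrow> (nat \<Rightarrow> 'o) \<Rightarrow> (nat \<Rightarrow> 'h) \<Rightarrow> (nat \<Rightarrow> 'h) \<Rightarrow> nat \<Rightarrow> 'h" where
  "summand_idempotent C T Ts inc prj i = Comp C T (Ts i) T (inc i) (prj i)"

text \<open>A path is given by its starting vertex and the list of its arrows.\<close>

definition path_algebra ::
  "('v, 'a) pre_digraph \<Rightarrow> (('v \<times> 'a list) \<Rightarrow>\<^sub>0 'k::zero) set" where
  "path_algebra Q = {c. \<forall>(u, p)\<in>Poly_Mapping.keys c. \<exists>v. pre_digraph.awalk Q u p v}"

text \<open>The \<open>m\<close>-th power of the arrow ideal.\<close>

definition arrow_ideal_power ::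
  "('v, 'a) pre_digraph \<Rightarrow> nat \<Rightarrow> (('v \<times> 'a list) \<Rightarrow>\<^sub>0 'k::zero) set" where
  "arrow_ideal_power Q m = {c \<in> path_algebra Q. \<forall>(u, p)\<in>Poly_Mapping.keys c. m \<le> length p}"

text \<open>
  The algebra homomorphism from the path algebra which sends the trivial path at \<open>u\<close> to \<open>e u\<close> and
  an arrow \<open>a\<close> to \<open>val a\<close>. Paths are multiplied like maps: the first arrow stands rightmost.
\<close>

primrec path_value ::
  "('b, 'k) kalg \<Rightarrow> ('v, 'a) pre_digraph \<Rightarrow> ('v \<Rightarrow> 'b) \<Rightarrow> ('a \<Rightarrow> 'b) \<Rightarrow> 'v \<Rightarrow> 'a list \<Rightarrow> 'b" where
  "path_value B Q e val u [] = e u"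
| "path_value B Q e val u (a # p) = amul B (path_value B Q e val (head Q a) p) (val a)"

definition path_algebra_hom ::
  "('b::ab_group_add, 'k::zero) kalg \<Rightarrow> ('v, 'a) pre_digraph \<Rightarrow> ('v \<Rightarrow> 'b) \<Rightarrow> ('a \<Rightarrow> 'b)
     \<Rightarrow> (('v \<times> 'a list) \<Rightarrow>\<^sub>0 'k) \<Rightarrow> 'b" where
  "path_algebra_hom B Q e val c =
     (\<Sum>(u, p)\<in>Poly_Mapping.keys c. ascl B (Poly_Mapping.lookup c (u, p)) (path_value B Q e val u p))"

text \<open>
  \<open>B = kQ/I\<close>, with \<open>e u\<close> the idempotent of the vertex \<open>u\<close>: the homomorphism \<open>kQ \<rightarrow> B\<close> above is
  surjective and its kernel \<open>I\<close> is admissible, i.e. \<open>R\<^sup>m \<subseteq> I \<subseteq> R\<^sup>2\<close> for the arrow ideal \<open>R\<close>.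
\<close>

definition bound_quiver_presentation ::
  "('b::ab_group_add, 'k::zero) kalg \<Rightarrow> ('v, 'a) pre_digraph \<Rightarrow> ('v \<Rightarrow> 'b) \<Rightarrow> ('a \<Rightarrow> 'b) \<Rightarrow> bool" where
  "bound_quiver_presentation B Q e val \<longleftrightarrow>
     fin_digraph Q \<and>
     (\<forall>a\<in>arcs Q. val a \<in> acar B \<and>
        amul B (e (head Q a)) (val a) = val a \<and> amul B (val a) (e (tail Q a)) = val a) \<and>
     path_algebra_hom B Q e val ` path_algebra Q = acar B \<and>
     (let I = {c \<in> path_algebra Q. path_algebra_hom B Q e val c = 0} in
      (\<exists>m\<ge>2. arrow_ideal_power Q m \<subseteq> I) \<and> I \<subseteq> arrow_ideal_power Q 2)"


section \<open>Modules\<close>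

text \<open>
  A left \<open>B\<close>-module \<open>M\<close> whose elements are those of the type \<open>'m\<close>, with scalar multiplication
  \<open>scl\<close> and action \<open>act\<close> of \<open>B\<close>.
\<close>

definition left_module ::
  "('b::ab_group_add, 'k::field) kalg \<Rightarrow> ('k \<Rightarrow> 'm \<Rightarrow> 'm) \<Rightarrow> ('b \<Rightarrow> 'm::ab_group_add \<Rightarrow> 'm) \<Rightarrow> bool" where
  "left_module B scl act \<longleftrightarrow> vector_space scl \<and>
     (\<forall>b\<in>acar B. Vector_Spaces.linear scl scl (act b)) \<and>
     (\<forall>b\<in>acar B. \<forall>b'\<in>acar B. \<forall>c x.
        act (b + b') x = act b x + act b' x \<and>
        act (ascl B c b) x = scl c (act b x) \<and>
        act (amul B b b') x = act b (act b' x)) \<and>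
     (\<forall>x. act (aone B) x = x)"

definition submodule ::
  "('b, 'k::field) kalg \<Rightarrow> ('k \<Rightarrow> 'm \<Rightarrow> 'm) \<Rightarrow> ('b \<Rightarrow> 'm::ab_group_add \<Rightarrow> 'm) \<Rightarrow> 'm set \<Rightarrow> bool" where
  "submodule B scl act N \<longleftrightarrow> module.subspace scl N \<and> (\<forall>b\<in>acar B. \<forall>x\<in>N. act b x \<in> N)"

definition indecomposable_module ::
  "('b, 'k::field) kalg \<Rightarrow> ('k \<Rightarrow> 'm \<Rightarrow> 'm) \<Rightarrow> ('b \<Rightarrow> 'm::ab_group_add \<Rightarrow> 'm) \<Rightarrow> bool" where
  "indecomposable_module B scl act \<longleftrightarrow> (UNIV :: 'm set) \<noteq> {0} \<and>
     (\<forall>N N'. submodule B scl act N \<and> submodule B scl act N' \<and>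
        N \<inter> N' = {0} \<and> (\<forall>z. \<exists>x\<in>N. \<exists>y\<in>N'. z = x + y) \<longrightarrow> N = {0} \<or> N' = {0})"

definition simple_submodule ::
  "('b, 'k::field) kalg \<Rightarrow> ('k \<Rightarrow> 'm \<Rightarrow> 'm) \<Rightarrow> ('b \<Rightarrow> 'm::ab_group_add \<Rightarrow> 'm) \<Rightarrow> 'm set \<Rightarrow> bool" where
  "simple_submodule B scl act N \<longleftrightarrow> submodule B scl act N \<and> N \<noteq> {0} \<and>
     (\<forall>N'. submodule B scl act N' \<and> N' \<subseteq> N \<longrightarrow> N' = {0} \<or> N' = N)"

definition maximal_submodule ::
  "('b, 'k::field) kalg \<Rightarrow> ('k \<Rightarrow> 'm \<Rightarrow> 'm) \<Rightarrow> ('b \<Rightarrow> 'm::ab_group_add \<Rightarrow> 'm) \<Rightarrow> 'm set \<Rightarrow> bool" where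
  "maximal_submodule B scl act N \<longleftrightarrow> submodule B scl act N \<and> N \<noteq> UNIV \<and>
     (\<forall>N'. submodule B scl act N' \<and> N \<subseteq> N' \<longrightarrow> N' = N \<or> N' = UNIV)"

definition socle ::
  "('b, 'k::field) kalg \<Rightarrow> ('k \<Rightarrow> 'm \<Rightarrow> 'm) \<Rightarrow> ('b \<Rightarrow> 'm::ab_group_add \<Rightarrow> 'm) \<Rightarrow> 'm set" where
  "socle B scl act = module.span scl (\<Union> {N. simple_submodule B scl act N})"

definition radical ::
  "('b, 'k::field) kalg \<Rightarrow> ('k \<Rightarrow> 'm \<Rightarrow> 'm) \<Rightarrow> ('b \<Rightarrow> 'm::ab_group_add \<Rightarrow> 'm) \<Rightarrow> 'm set" where
  "radical B scl act = \<Inter> {N. maximal_submodule B scl act N}"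

definition uniserial ::
  "('b, 'k::field) kalg \<Rightarrow> ('k \<Rightarrow> 'm \<Rightarrow> 'm) \<Rightarrow> ('b \<Rightarrow> 'm::ab_group_add \<Rightarrow> 'm) \<Rightarrow> 'm set \<Rightarrow> bool" where
  "uniserial B scl act N \<longleftrightarrow> submodule B scl act N \<and>
     (\<forall>K L. submodule B scl act K \<and> submodule B scl act L \<and> K \<subseteq> N \<and> L \<subseteq> N \<longrightarrow> K \<subseteq> L \<or> L \<subseteq> K)"

text \<open>\<open>N\<close> has a composition series of length \<open>l\<close>.\<close>

definition has_composition_length ::
  "('b, 'k::field) kalg \<Rightarrow> ('k \<Rightarrow> 'm \<Rightarrow> 'm) \<Rightarrow> ('b \<Rightarrow> 'm::ab_group_add \<Rightarrow> 'm) \<Rightarrow> 'm set \<Rightarrow> nat \<Rightarrow> bool" where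
  "has_composition_length B scl act N l \<longleftrightarrow>
     (\<exists>Ns :: nat \<Rightarrow> 'm set. Ns 0 = {0} \<and> Ns l = N \<and>
        (\<forall>i\<le>l. submodule B scl act (Ns i)) \<and>
        (\<forall>i<l. Ns i \<subset> Ns (Suc i) \<and>
           \<not> (\<exists>K. submodule B scl act K \<and> Ns i \<subset> K \<and> K \<subset> Ns (Suc i))))"

text \<open>The simple module \<open>S(v)\<close> is a composition factor of \<open>N/K\<close>, i.e. \<open>e v \<cdot> (N/K) \<noteq> 0\<close>.\<close>

definition composition_factor ::
  "('v \<Rightarrow> 'b) \<Rightarrow> ('b \<Rightarrow> 'm \<Rightarrow> 'm) \<Rightarrow> 'm set \<Rightarrow> 'm set \<Rightarrow> 'v \<Rightarrow> bool" where
  "composition_factor e act N K v \<longleftrightarrow> (\<exists>x\<in>N. act (e v) x \<notin> K)"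

definition valley ::
  "('b, 'k::field) kalg \<Rightarrow> ('v \<Rightarrow> 'b) \<Rightarrow> ('k \<Rightarrow> 'm \<Rightarrow> 'm) \<Rightarrow> ('b \<Rightarrow> 'm::ab_group_add \<Rightarrow> 'm) \<Rightarrow> 'v \<Rightarrow> bool" where
  "valley B e scl act v \<longleftrightarrow> composition_factor e act (socle B scl act) {0} v"

definition peak ::
  "('b, 'k::field) kalg \<Rightarrow> ('v \<Rightarrow> 'b) \<Rightarrow> ('k \<Rightarrow> 'm \<Rightarrow> 'm) \<Rightarrow> ('b \<Rightarrow> 'm::ab_group_add \<Rightarrow> 'm) \<Rightarrow> 'v \<Rightarrow> bool" where
  "peak B e scl act v \<longleftrightarrow> composition_factor e act UNIV (radical B scl act) v"


section \<open>Strings and shapes\<close>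

text \<open>
  A string: pairwise distinct vertices \<open>vs\<close> and, for each pair of neighbours \<open>vs ! p\<close> and
  \<open>vs ! Suc p\<close>, an arrow \<open>as ! p\<close> between them, in either direction.
\<close>

definition is_string :: "('v, 'a) pre_digraph \<Rightarrow> 'v list \<Rightarrow> 'a list \<Rightarrow> bool" where
  "is_string Q vs as \<longleftrightarrow> length vs = Suc (length as) \<and> distinct vs \<and> set vs \<subseteq> verts Q \<and>
     (\<forall>p<length as. as ! p \<in> arcs Q \<and>
        {tail Q (as ! p), head Q (as ! p)} = {vs ! p, vs ! Suc p})"

text \<open>
  \<open>M\<close> is isomorphic to the string module of \<open>(vs, as)\<close>: it has a basis \<open>x\<close> indexed by the positions
  in the string, with \<open>x p\<close> in the component at the vertex \<open>vs ! p\<close>, such that the arrows of the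
  string map the basis vector at their tail to the one at their head and everything else to 0.
\<close>

definition is_string_module ::
  "('v, 'a) pre_digraph \<Rightarrow> ('v \<Rightarrow> 'b) \<Rightarrow> ('a \<Rightarrow> 'b) \<Rightarrow> ('k::field \<Rightarrow> 'm \<Rightarrow> 'm)
     \<Rightarrow> ('b \<Rightarrow> 'm::ab_group_add \<Rightarrow> 'm) \<Rightarrow> 'v list \<Rightarrow> 'a list \<Rightarrow> bool" where
  "is_string_module Q e val scl act vs as \<longleftrightarrow> is_string Q vs as \<and>
     (\<exists>x. inj_on x {..<length vs} \<and> \<not> module.dependent scl (x ` {..<length vs}) \<and>
        module.span scl (x ` {..<length vs}) = UNIV \<and>
        (\<forall>p<length vs. act (e (vs ! p)) (x p) = x p) \<and>
        (\<forall>a\<in>arcs Q. \<forall>p<length vs. act (val a) (x p) =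
           (if Suc p < length vs \<and> as ! p = a \<and> tail Q a = vs ! p then x (Suc p)
            else if 0 < p \<and> as ! (p - 1) = a \<and> tail Q a = vs ! p then x (p - 1)
            else 0)))"

text \<open>
  \<open>M\<close>, given by a string \<open>(vs, as)\<close>, is of shape \<open>ks\<close>. The list \<open>ps\<close> consists of the positions of
  \<open>S(1), \<dots>, S(m + 1)\<close>, i.e. of the peaks and valleys from left to right; if \<open>M\<close> is simple, its
  single factor is both a peak and a valley and is listed twice, so that \<open>m = 1\<close>. The composition
  factors of \<open>N\<close> are those of the leg between two neighbours in \<open>ps\<close> except the peak. As lists start
  at 0, the number \<open>k\<^sub>i\<close> is \<open>ks ! (i - 1)\<close>.
\<close>

definition has_shape ::
  "('b, 'k::field) kalg \<Rightarrow> ('v, 'a) pre_digraph \<Rightarrow> ('v \<Rightarrow> 'b) \<Rightarrow> ('a \<Rightarrow> 'b)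
     \<Rightarrow> ('k \<Rightarrow> 'm \<Rightarrow> 'm) \<Rightarrow> ('b \<Rightarrow> 'm::ab_group_add \<Rightarrow> 'm) \<Rightarrow> nat list \<Rightarrow> bool" where
  "has_shape B Q e val scl act ks \<longleftrightarrow>
     (\<exists>vs as ps. is_string_module Q e val scl act vs as \<and>
        sorted ps \<and> (if length vs = 1 then length ps = 2 else distinct ps) \<and>
        set ps = {p. p < length vs \<and> (peak B e scl act (vs ! p) \<or> valley B e scl act (vs ! p))} \<and>
        length ps = Suc (length ks) \<and>
        (\<forall>i<length ks. \<exists>N. uniserial B scl act N \<and>
           {v \<in> verts Q. composition_factor e act N {0} v} =
             {vs ! p |p. ps ! i \<le> p \<and> p \<le> ps ! Suc i \<and> \<not> peak B e scl act (vs ! p)} \<and>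
           has_composition_length B scl act N (ks ! i)))"

definition admissible :: "nat set \<Rightarrow> bool" where
  "admissible I \<longleftrightarrow>
     (\<forall>i\<in>I. \<forall>j\<in>I. i < j \<and> {i<..<j} \<inter> I = {} \<longrightarrow> even (card {i<..<j}))"

end

theory Submission
  imports Defs
begin

text \<open>
  A submodule of a string module is spanned by the basis vectors it contains, because the vertices of
  the string are distinct and so the idempotents separate the basis. Submodules therefore correspond
  to the sets of positions that are closed under following the arrows of the string. Splitting these
  sets according to whether they contain the left end of the current leg gives two numbers; an
  additional leg of length \<open>k\<close> on the left changes them from \<open>(u, w)\<close> to \<open>(w + k u, u)\<close>. The sums
  over the admissible sets whose least element is odd, respectively even (with the empty set counted
  in both), obey the same recursion.
\<close>


section \<open>Admissible sets\<close>

text \<open>The pair is read relative to the direction of the leg, because membership of the left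
  end means different things at a peak and at a valley: \<open>u\<close> counts the closed sets that
  omit a peak or contain a valley there, \<open>w\<close> the others. The sets behind
  \<open>w\<close> are forced on the whole leg; those behind \<open>u\<close> are constant on it or
  change at one of \<open>k\<close> positions, whence the factor \<open>k\<close>. The next leg
  points the other way, so the two roles swap, and one recursion serves both directions. The start
  \<open>(1, 1)\<close> is a single position, contained or not. For admissible sets the swap is the
  change of parity under a shift of the indices. The summand 1 of the formula is the second
  occurrence of the empty set. The obstacle is that the shape is given by the module: peaks by the
  radical, valleys by the socle, each \<open>k\<close> by the length of a submodule known only
  through its factors. All of this is read off from positions by enlarging or shrinking closed sets
  one position at a time.\<close>

fun leg_counts :: "nat list \<Rightarrow> nat \<times> nat" where
  "leg_counts [] = (1, 1)"
| "leg_counts (k # ks) = (case leg_counts ks of (u, w) \<Rightarrow> (w + k * u, u))"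

text \<open>The guard singles out the least element without naming it, so that the condition is
  vacuous for the empty set.\<close>

definition starts :: "bool \<Rightarrow> nat set \<Rightarrow> bool" where
  "starts b I \<longleftrightarrow> (\<forall>i\<in>I. I \<inter> {..<i} = {} \<longrightarrow> odd i = b)"

lemma image_Suc_greaterThanLessThan: "Suc ` {i<..<j} = {Suc i<..<Suc j}"
proof (intro equalityI subsetI)
  fix x assume "x \<in> {Suc i<..<Suc j}"
  then show "x \<in> Suc ` {i<..<j}" by (cases x) auto
qed auto

lemma admissible_image_Suc: "admissible (Suc ` I) \<longleftrightarrow> admissible I"
proof -
  have "{Suc i<..<Suc j} \<inter> Suc ` I = Suc ` ({i<..<j} \<inter> I)" for i j
    by (auto simp flip: image_Suc_greaterThanLessThan)
  then show ?thesis unfolding admissible_def by auto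
qed

lemma starts_image_Suc: "starts b (Suc ` I) \<longleftrightarrow> starts (\<not> b) I"
proof -
  have "Suc ` I \<inter> {..<Suc i} = Suc ` (I \<inter> {..<i})" for i by auto
  then show ?thesis unfolding starts_def by auto
qed

text \<open>The gaps inside \<open>I\<close> are merely shifted. The only new gap runs from 1 to the
  shifted least element \<open>Suc j\<close> and has \<open>j - 1\<close> members, so it is even
  exactly if \<open>j\<close> is odd.\<close>

lemma admissible_insert_1:
  assumes "0 \<notin> I"
  shows "admissible (insert 1 (Suc ` I)) \<longleftrightarrow> admissible I \<and> starts True I"
proof -
  let ?J = "insert 1 (Suc ` I)"
  have g1: "{Suc i<..<Suc j} \<inter> ?J = Suc ` ({i<..<j} \<inter> I)" for i j
    by (auto simp flip: image_Suc_greaterThanLessThan)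
  have g2: "{1<..<Suc j} \<inter> ?J = Suc ` (I \<inter> {..<j})" for j
    using assms gr0I by fastforce
  show ?thesis
  proof
    assume a: "admissible ?J"
    have "admissible I" unfolding admissible_def
    proof (intro ballI impI)
      fix i j assume "i \<in> I" "j \<in> I" "i < j \<and> {i<..<j} \<inter> I = {}"
      then have "even (card {Suc i<..<Suc j})"
        using a[unfolded admissible_def, rule_format, of "Suc i" "Suc j"] g1[of i j] by auto
      then show "even (card {i<..<j})" by simp
    qed
    moreover have "starts True I" unfolding starts_def
    proof (intro ballI impI)
      fix j assume j: "j \<in> I" "I \<inter> {..<j} = {}"
      \<comment> \<open>The parity of \<open>j - 1\<close> is opposite to that of \<open>j\<close>
        only for positive \<open>j\<close>, as the subtraction truncates.\<close>
      then have "j > 0" using assms by (cases j) auto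
      then have "even (card {1<..<Suc j})"
        using a[unfolded admissible_def, rule_format, of 1 "Suc j"] g2[of j] j by auto
      then show "odd j = True" using \<open>j > 0\<close> by simp
    qed
    ultimately show "admissible I \<and> starts True I" ..
  next
    assume a: "admissible I \<and> starts True I"
    show "admissible ?J" unfolding admissible_def
    proof (intro ballI impI)
      fix i j assume ij: "i \<in> ?J" "j \<in> ?J" "i < j \<and> {i<..<j} \<inter> ?J = {}"
      then obtain j' where j': "j = Suc j'" "j' \<in> I" by auto
      show "even (card {i<..<j})"
      proof (cases "i = 1")
        case True
        then have "I \<inter> {..<j'} = {}" using ij j' g2[of j'] by auto
        then have "odd j'" using a j' unfolding starts_def by auto
        then show ?thesis using True j' by simp
      next
        case False
        then obtain i' where i': "i = Suc i'" "i' \<in> I" using ij by auto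
        then have "{i'<..<j'} \<inter> I = {}" using ij j' g1[of i' j'] by auto
        then have "even (card {i'<..<j'})"
          using a ij i' j' unfolding admissible_def by auto
        then show ?thesis using i' j' by simp
      qed
    qed
  qed
qed

section \<open>Recursion for admissible sets by the parity of the least element\<close>

definition adm_sets :: "bool \<Rightarrow> nat \<Rightarrow> nat set set" where
  "adm_sets b m = {I. I \<subseteq> {1..m} \<and> admissible I \<and> starts b I}"

lemma finite_adm_sets: "finite (adm_sets b m)"
  unfolding adm_sets_def by (rule finite_subset[of _ "Pow {1..m}"]) auto

lemma subset_Suc_image:
  assumes "I \<subseteq> {1..Suc m}" "1 \<notin> I"
  obtains J where "J \<subseteq> {1..m}" "I = Suc ` J"
proof
  show "(\<lambda>i. i - 1) ` I \<subseteq> {1..m}"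
  proof
    fix y assume "y \<in> (\<lambda>i. i - 1) ` I"
    then obtain i where i: "i \<in> I" "y = i - 1" by auto
    then have "i \<noteq> 1" "1 \<le> i" "i \<le> Suc m" using assms by auto
    then show "y \<in> {1..m}" using i by auto
  qed
  show "I = Suc ` (\<lambda>i. i - 1) ` I" using assms by (force simp: image_image image_iff)
qed

lemma starts_insert_1:
  assumes "0 \<notin> I"
  shows "starts b (insert 1 I) \<longleftrightarrow> b"
proof -
  have "insert 1 I \<inter> {..<i} = {} \<longleftrightarrow> i \<le> 1" for i by (cases i) (use assms in auto)
  moreover have "i = 1" if "i \<in> insert 1 I" "i \<le> 1" for i
    using that assms by (cases i) auto
  ultimately show ?thesis unfolding starts_def by (metis insertI1 odd_one order_refl)
qed

text \<open>An even least element excludes 1, so the whole set is a shift, and shifting back makes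
  its least element odd. This is the second component of the recursion.\<close>

lemma adm_sets_False_Suc: "adm_sets False (Suc m) = (`) Suc ` adm_sets True m"
proof (intro equalityI subsetI)
  fix I assume I: "I \<in> adm_sets False (Suc m)"
  then have "1 \<notin> I"
    using starts_insert_1[of I False] unfolding adm_sets_def by (fastforce simp: insert_absorb)
  with I obtain J where J: "J \<subseteq> {1..m}" "I = Suc ` J"
    unfolding adm_sets_def by (blast elim: subset_Suc_image)
  then have "J \<in> adm_sets True m" using I
    unfolding adm_sets_def by (auto simp: admissible_image_Suc starts_image_Suc)
  with J show "I \<in> (`) Suc ` adm_sets True m" by blast
qed (auto simp: adm_sets_def admissible_image_Suc starts_image_Suc)

text \<open>Either 1 is missing and the set is a shift, or 1 is present and, by
  \<open>admissible_insert_1\<close>, the rest is a shifted set with odd least element. This is the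
  first component of the recursion.\<close>

lemma adm_sets_True_Suc:
  "adm_sets True (Suc m) =
     (`) Suc ` adm_sets False m \<union> (\<lambda>I. insert 1 (Suc ` I)) ` adm_sets True m"
proof (intro equalityI subsetI)
  fix I assume I: "I \<in> adm_sets True (Suc m)"
  show "I \<in> (`) Suc ` adm_sets False m \<union> (\<lambda>I. insert 1 (Suc ` I)) ` adm_sets True m"
  proof (cases "1 \<in> I")
    case False
    with I obtain J where J: "J \<subseteq> {1..m}" "I = Suc ` J"
      unfolding adm_sets_def by (blast elim: subset_Suc_image)
    then have "J \<in> adm_sets False m" using I
      unfolding adm_sets_def by (auto simp: admissible_image_Suc starts_image_Suc)
    with J show ?thesis by blast
  next
    case True
    have "I - {1} \<subseteq> {1..Suc m}" "1 \<notin> I - {1}" using I unfolding adm_sets_def by auto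
    then obtain J where J: "J \<subseteq> {1..m}" "I - {1} = Suc ` J" by (rule subset_Suc_image)
    then have eq: "I = insert 1 (Suc ` J)" using True by auto
    have "0 \<notin> J" using J by auto
    then have "J \<in> adm_sets True m" using I J
      unfolding adm_sets_def eq by (auto simp: admissible_insert_1[simplified])
    with eq show ?thesis by blast
  qed
next
  fix I assume "I \<in> (`) Suc ` adm_sets False m \<union> (\<lambda>I. insert 1 (Suc ` I)) ` adm_sets True m"
  then consider J where "J \<in> adm_sets False m" "I = Suc ` J"
    | J where "J \<in> adm_sets True m" "I = insert 1 (Suc ` J)" by blast
  then show "I \<in> adm_sets True (Suc m)"
  proof cases
    case 1
    then show ?thesis by (auto simp: adm_sets_def admissible_image_Suc starts_image_Suc)
  next
    case 2
    then have "0 \<notin> J" unfolding adm_sets_def by auto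
    then show ?thesis using 2 admissible_insert_1[of J] starts_insert_1[of "Suc ` J" True]
      by (auto simp: adm_sets_def)
  qed
qed

text \<open>The head \<open>k\<close> belongs to the index 1, which a shifted set of positive
  indices avoids; all other weights move along with their index.\<close>

lemma prod_shift: "(\<Prod>i\<in>Suc ` I. (k # ks) ! (i - 1)) = (\<Prod>i\<in>I. ks ! (i - 1))"
  if "I \<subseteq> {1..m}" for k :: nat
proof -
  have "(\<Prod>i\<in>Suc ` I. (k # ks) ! (i - 1)) = (\<Prod>i\<in>I. (k # ks) ! i)"
    by (subst prod.reindex) auto
  also have "\<dots> = (\<Prod>i\<in>I. ks ! (i - 1))"
    by (rule prod.cong) (use that in \<open>auto simp: nth_Cons' subset_iff\<close>)
  finally show ?thesis .
qed

text \<open>The two families in \<open>adm_sets_True_Suc\<close> are disjoint, being told apart by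
  membership of 1; in the second one the index 1 contributes the factor \<open>k\<close>.\<close>

lemma leg_counts_eq_sums:
  "leg_counts ks = (\<Sum>I\<in>adm_sets True (length ks). \<Prod>i\<in>I. ks ! (i - 1),
                    \<Sum>I\<in>adm_sets False (length ks). \<Prod>i\<in>I. ks ! (i - 1))"
proof (induction ks)
  case Nil
  have "adm_sets b 0 = {{}}" for b
    unfolding adm_sets_def by (auto simp: admissible_def starts_def)
  then show ?case by simp
next
  case (Cons k ks)
  let ?m = "length ks"
  let ?g = "\<lambda>I. \<Prod>i\<in>I. (k # ks) ! (i - 1)" and ?f = "\<lambda>I. \<Prod>i\<in>I. ks ! (i - 1)"
  have inj: "inj_on ((`) Suc) X" for X by (simp add: inj_on_def inj_image_eq_iff)
  have shift: "sum ?g ((`) Suc ` adm_sets b ?m) = sum ?f (adm_sets b ?m)" for b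
    by (subst sum.reindex[OF inj])
      (auto intro!: sum.cong prod_shift simp: adm_sets_def simp del: One_nat_def)
  have inj': "inj_on (\<lambda>I. insert 1 (Suc ` I)) (adm_sets True ?m)"
  proof (rule inj_onI)
    fix I J assume a: "I \<in> adm_sets True ?m" "J \<in> adm_sets True ?m"
      "insert 1 (Suc ` I) = insert 1 (Suc ` J)"
    then have "1 \<notin> Suc ` I" "1 \<notin> Suc ` J" unfolding adm_sets_def by auto
    with a have "Suc ` I = Suc ` J" by (metis insert_ident)
    then show "I = J" by (simp add: inj_image_eq_iff)
  qed
  have "sum ?g ((\<lambda>I. insert 1 (Suc ` I)) ` adm_sets True ?m) = (\<Sum>I\<in>adm_sets True ?m. k * ?f I)"
    unfolding sum.reindex[OF inj'] o_def
  proof (rule sum.cong[OF refl])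
    fix I assume I: "I \<in> adm_sets True ?m"
    then have "finite I" "I \<subseteq> {1..?m}" "1 \<notin> Suc ` I"
      unfolding adm_sets_def by (auto dest: finite_subset)
    then show "?g (insert 1 (Suc ` I)) = k * ?f I"
      using prod_shift[of I ?m k ks] by (subst prod.insert) auto
  qed
  moreover have "(`) Suc ` adm_sets False ?m \<inter> (\<lambda>I. insert 1 (Suc ` I)) ` adm_sets True ?m = {}"
  proof -
    have "Suc ` I \<noteq> insert 1 (Suc ` J)" if "I \<in> adm_sets False ?m" for I J
    proof -
      have "1 \<notin> Suc ` I" using that unfolding adm_sets_def by auto
      then show ?thesis by blast
    qed
    then show ?thesis by blast
  qed
  ultimately have "sum ?g (adm_sets True (Suc ?m)) =
      sum ?f (adm_sets False ?m) + k * sum ?f (adm_sets True ?m)"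
    unfolding adm_sets_True_Suc
    by (subst sum.union_disjoint) (simp_all add: finite_adm_sets shift sum_distrib_left del: One_nat_def)
  moreover have "sum ?g (adm_sets False (Suc ?m)) = sum ?f (adm_sets True ?m)"
    unfolding adm_sets_False_Suc by (rule shift)
  ultimately show ?case using Cons.IH by simp
qed

text \<open>A nonempty set has exactly one least element and lies in exactly one parity class. The
  empty set lies in both and has product 1, which accounts for the additional 1.\<close>

lemma admissible_sum:
  assumes "m = length ks"
  shows "1 + (\<Sum>j=0..m. \<Sum>I | I \<subseteq> {1..m} \<and> card I = m - j \<and> admissible I.
                \<Prod>i\<in>I. ks ! (i - 1)) = fst (leg_counts ks) + snd (leg_counts ks)"
proof -
  let ?f = "\<lambda>I. \<Prod>i\<in>I. ks ! (i - 1)"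
  let ?A = "{I. I \<subseteq> {1..m} \<and> admissible I}"
  have finA: "finite ?A" by (rule finite_subset[of _ "Pow {1..m}"]) auto
  have cardle: "card I \<le> m" if "I \<subseteq> {1..m}" for I
    using card_mono[OF _ that] by simp
  \<comment> \<open>Since \<open>card I \<le> m\<close>, the condition on the cardinality can be
    solved for \<open>j\<close>; this makes \<open>j\<close> a function of \<open>I\<close>, and the
    inner sums are its fibres.\<close>
  have "(\<Sum>j=0..m. \<Sum>I | I \<subseteq> {1..m} \<and> card I = m - j \<and> admissible I. ?f I) =
      (\<Sum>j=0..m. sum ?f {I \<in> ?A. m - card I = j})"
  proof (intro sum.cong refl set_eqI)
    fix j I assume "j \<in> {0..m}"
    then show "I \<in> {I. I \<subseteq> {1..m} \<and> card I = m - j \<and> admissible I} \<longleftrightarrow>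
        I \<in> {I \<in> ?A. m - card I = j}"
      using cardle[of I] by auto
  qed
  also have "\<dots> = sum ?f ?A"
    by (rule sum.group[OF finA]) auto
  also have "?A = adm_sets True m \<union> (adm_sets False m - {{}})"
  proof -
    have "starts True I \<or> starts False I" for I
    proof (rule ccontr)
      assume "\<not> ?thesis"
      then obtain i j where "i \<in> I" "I \<inter> {..<i} = {}" "even i" "j \<in> I" "I \<inter> {..<j} = {}" "odd j"
        unfolding starts_def by auto
      then show False by (metis IntI empty_iff lessThan_iff linorder_neqE_nat)
    qed
    then show ?thesis unfolding adm_sets_def by (auto simp: starts_def)
  qed
  also have "sum ?f \<dots> = sum ?f (adm_sets True m) + sum ?f (adm_sets False m - {{}})"
  proof (rule sum.union_disjoint)
    show "adm_sets True m \<inter> (adm_sets False m - {{}}) = {}"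
    proof (rule ccontr)
      assume "\<not> ?thesis"
      then obtain I where I: "I \<noteq> {}" "starts True I" "starts False I"
        unfolding adm_sets_def by auto
      define i where "i = (LEAST i. i \<in> I)"
      have "i \<in> I" "I \<inter> {..<i} = {}"
        unfolding i_def using I(1) by (auto intro: LeastI dest: not_less_Least)
      then show False using I unfolding starts_def by auto
    qed
  qed (auto simp: finite_adm_sets)
  also have "1 + \<dots> = sum ?f (adm_sets True m) + sum ?f (adm_sets False m)"
  proof -
    have "{} \<in> adm_sets False m" unfolding adm_sets_def by (auto simp: admissible_def starts_def)
    then show ?thesis using sum.remove[OF finite_adm_sets, of "{}" False m ?f] by simp
  qed
  finally show ?thesis unfolding leg_counts_eq_sums assms by simp
qed


section \<open>Closed sets of positions in a string\<close>

text \<open>\<open>d p\<close> tells whether the arrow between the positions \<open>p\<close> and \<open>p + 1\<close> points to the right.\<close>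

definition ideals :: "(nat \<Rightarrow> bool) \<Rightarrow> nat \<Rightarrow> nat \<Rightarrow> nat set set" where
  "ideals d a b = {S. S \<subseteq> {a..b} \<and>
     (\<forall>p\<in>{a..<b}. if d p then p \<in> S \<longrightarrow> Suc p \<in> S else Suc p \<in> S \<longrightarrow> p \<in> S)}"

lemma finite_ideals: "finite (ideals d a b)"
  unfolding ideals_def by (rule finite_subset[of _ "Pow {a..b}"]) auto

text \<open>Each rule asks for one bound only; the other one follows from the membership premise, as
  \<open>S\<close> lies in \<open>{a..b}\<close>.\<close>

lemma idealsD:
  assumes "S \<in> ideals d a b"
  shows "p \<in> S \<Longrightarrow> p < b \<Longrightarrow> d p \<Longrightarrow> Suc p \<in> S"
    and "Suc p \<in> S \<Longrightarrow> a \<le> p \<Longrightarrow> \<not> d p \<Longrightarrow> p \<in> S"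
proof -
  have S: "S \<subseteq> {a..b}"
    and closed: "\<And>p. p \<in> {a..<b} \<Longrightarrow>
      if d p then p \<in> S \<longrightarrow> Suc p \<in> S else Suc p \<in> S \<longrightarrow> p \<in> S"
    using assms unfolding ideals_def by blast+
  show "p \<in> S \<Longrightarrow> p < b \<Longrightarrow> d p \<Longrightarrow> Suc p \<in> S"
    using subsetD[OF S, of p] closed[of p] by simp
  show "Suc p \<in> S \<Longrightarrow> a \<le> p \<Longrightarrow> \<not> d p \<Longrightarrow> p \<in> S"
    using subsetD[OF S, of "Suc p"] closed[of p] by simp
qed

lemma ideals_subset: "S \<in> ideals d a b \<Longrightarrow> S \<subseteq> {a..b}"
  unfolding ideals_def by blast

lemma empty_mem_ideals [simp]: "{} \<in> ideals d a b"
  and atLeastAtMost_mem_ideals [simp]: "{a..b} \<in> ideals d a b"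
  unfolding ideals_def by auto

text \<open>
  The height drops by 1 along every arrow, so a position of extremal height in a difference of two
  ideals can be added to the smaller one or removed from the larger one.
\<close>

definition height :: "(nat \<Rightarrow> bool) \<Rightarrow> nat \<Rightarrow> int" where
  "height d p = (\<Sum>q<p. if d q then - 1 else 1)"

lemma height_Suc: "height d (Suc p) = height d p + (if d p then - 1 else 1)"
  unfolding height_def by simp

text \<open>Minimality is stated contrapositively, ready to exclude the lower neighbours of
  \<open>p\<close> from the set.\<close>

lemma finite_arg_min:
  fixes f :: "'a \<Rightarrow> int"
  assumes "finite A" "A \<noteq> {}"
  obtains p where "p \<in> A" "\<And>q. f q < f p \<Longrightarrow> q \<notin> A"
proof -
  have "Min (f ` A) \<in> f ` A" using assms by (intro Min_in) auto
  then obtain p where p: "p \<in> A" "Min (f ` A) = f p" by auto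
  have "f p \<le> f q" if "q \<in> A" for q
    unfolding p(2)[symmetric] using assms that by (intro Min_le) auto
  with p(1) that show thesis by (meson not_less)
qed

text \<open>Take \<open>p\<close> of least height in \<open>S' - S\<close>. An arrow out of
  \<open>p\<close> ends lower and inside \<open>S'\<close>, hence in \<open>S\<close> by
  minimality.\<close>

lemma ideal_insert:
  assumes "S \<in> ideals d a b" "S' \<in> ideals d a b" "S \<subset> S'"
  obtains p where "p \<in> S' - S" "insert p S \<in> ideals d a b"
proof -
  have "finite (S' - S)" using ideals_subset[OF assms(2)] by (auto dest: finite_subset)
  then obtain p where p: "p \<in> S' - S" and min: "\<And>q. height d q < height d p \<Longrightarrow> q \<notin> S' - S"
    using finite_arg_min[of "S' - S" "height d"] assms(3) by blast
  have "if d q then q \<in> insert p S \<longrightarrow> Suc q \<in> insert p S else Suc q \<in> insert p S \<longrightarrow> q \<in> insert p S"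
    if "q \<in> {a..<b}" for q
    using idealsD[OF assms(1), of q] idealsD[OF assms(2), of q] p that
      min[of q] min[of "Suc q"] by (auto simp: height_Suc split: if_splits)
  then have "insert p S \<in> ideals d a b"
    using ideals_subset[OF assms(1)] ideals_subset[OF assms(2)] p unfolding ideals_def by blast
  with p that show thesis by blast
qed

text \<open>Take \<open>p\<close> of greatest height in \<open>S' - S\<close>. An arrow into
  \<open>p\<close> from a position of \<open>S'\<close> starts higher, hence in \<open>S\<close> by
  maximality, which would force \<open>p\<close> into \<open>S\<close>.\<close>

lemma ideal_remove:
  assumes "S \<in> ideals d a b" "S' \<in> ideals d a b" "S \<subset> S'"
  obtains p where "p \<in> S' - S" "S' - {p} \<in> ideals d a b"
proof -
  have "finite (S' - S)" using ideals_subset[OF assms(2)] by (auto dest: finite_subset)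
  then obtain p where p: "p \<in> S' - S" and max: "\<And>q. - height d q < - height d p \<Longrightarrow> q \<notin> S' - S"
    using finite_arg_min[of "S' - S" "\<lambda>p. - height d p"] assms(3) by blast
  have "if d q then q \<in> S' - {p} \<longrightarrow> Suc q \<in> S' - {p} else Suc q \<in> S' - {p} \<longrightarrow> q \<in> S' - {p}"
    if "q \<in> {a..<b}" for q
    using idealsD[OF assms(1), of q] idealsD[OF assms(2), of q] p that
      max[of q] max[of "Suc q"] by (auto simp: height_Suc split: if_splits)
  then have "S' - {p} \<in> ideals d a b"
    using ideals_subset[OF assms(2)] unfolding ideals_def by blast
  with p that show thesis by blast
qed

section \<open>Counting closed sets leg by leg\<close>

definition ideal_count :: "(nat \<Rightarrow> bool) \<Rightarrow> nat \<Rightarrow> nat \<Rightarrow> bool \<Rightarrow> nat" where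
  "ideal_count d b a c = card {S \<in> ideals d a b. (a \<in> S) = c}"

lemma card_ideals: "card (ideals d a b) = ideal_count d b a c + ideal_count d b a (\<not> c)"
proof -
  let ?X = "\<lambda>c. {S \<in> ideals d a b. (a \<in> S) = c}"
  have "ideals d a b = ?X c \<union> ?X (\<not> c)" by blast
  then have "card (ideals d a b) = card (?X c \<union> ?X (\<not> c))" by (rule arg_cong)
  also have "\<dots> = card (?X c) + card (?X (\<not> c))"
    by (rule card_Un_disjoint) (auto simp: finite_ideals)
  finally show ?thesis unfolding ideal_count_def .
qed

lemma ideal_count_last: "ideal_count d b b c = 1"
proof -
  have "{S \<in> ideals d b b. (b \<in> S) = c} = {if c then {b} else {}}"
    unfolding ideals_def by (cases c) auto
  then show ?thesis unfolding ideal_count_def by simp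
qed

text \<open>Only the arrow between \<open>a\<close> and \<open>Suc a\<close> constrains
  \<open>a\<close>. Pointing right, it transfers membership from \<open>a\<close> to
  \<open>Suc a\<close>; pointing left, it transfers non-membership. In both cases the value
  \<open>d a\<close> at \<open>a\<close> forces the value \<open>d a\<close> at
  \<open>Suc a\<close>, while the opposite value leaves \<open>Suc a\<close> free.\<close>

lemma bij_betw_ideals_Suc:
  assumes "a < b"
  shows "bij_betw (\<lambda>S. S - {a}) {S \<in> ideals d a b. (a \<in> S) = c}
     {S \<in> ideals d (Suc a) b. c = d a \<longrightarrow> (Suc a \<in> S) = d a}"
proof (rule bij_betw_byWitness[where f' = "\<lambda>S. if c then insert a S else S"])
  show "(\<lambda>S. S - {a}) ` {S \<in> ideals d a b. (a \<in> S) = c} \<subseteq>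
      {S \<in> ideals d (Suc a) b. c = d a \<longrightarrow> (Suc a \<in> S) = d a}"
  proof clarify
    fix S assume S: "S \<in> ideals d a b"
    have "S - {a} \<in> ideals d (Suc a) b"
      using S assms unfolding ideals_def by (fastforce split: if_splits)
    then show "S - {a} \<in> ideals d (Suc a) b \<and> ((a \<in> S) = d a \<longrightarrow> (Suc a \<in> S - {a}) = d a)"
      using idealsD[OF S, of a] assms by auto
  qed
  show "(\<lambda>S. if c then insert a S else S) `
      {S \<in> ideals d (Suc a) b. c = d a \<longrightarrow> (Suc a \<in> S) = d a} \<subseteq> {S \<in> ideals d a b. (a \<in> S) = c}"
  proof clarify
    fix S assume S: "S \<in> ideals d (Suc a) b" "c = d a \<longrightarrow> (Suc a \<in> S) = d a"
    have a: "a \<notin> S" using ideals_subset[OF S(1)] by auto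
    define T where "T = (if c then insert a S else S)"
    have T: "a \<in> T \<longleftrightarrow> c" "\<And>p. p \<noteq> a \<Longrightarrow> p \<in> T \<longleftrightarrow> p \<in> S"
      using a unfolding T_def by auto
    have "if d p then p \<in> T \<longrightarrow> Suc p \<in> T else Suc p \<in> T \<longrightarrow> p \<in> T" if "p \<in> {a..<b}" for p
    proof (cases "p = a")
      case True
      then show ?thesis using T(1) T(2)[of "Suc a"] S(2) by auto
    next
      case False
      then show ?thesis using T(2)[of p] T(2)[of "Suc p"] idealsD[OF S(1), of p] that by auto
    qed
    moreover have "T \<subseteq> {a..b}"
      using ideals_subset[OF S(1)] assms unfolding T_def by (cases c) fastforce+
    ultimately have "T \<in> ideals d a b" unfolding ideals_def by blast
    with T(1) show "(if c then insert a S else S) \<in> ideals d a b \<and>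
        (a \<in> (if c then insert a S else S)) = c"
      unfolding T_def by blast
  qed
  show "\<forall>S\<in>{S \<in> ideals d a b. (a \<in> S) = c}. (if c then insert a (S - {a}) else S - {a}) = S"
    by auto
  have "a \<notin> S" if "S \<in> ideals d (Suc a) b" for S using ideals_subset[OF that] by auto
  then show "\<forall>S\<in>{S \<in> ideals d (Suc a) b. c = d a \<longrightarrow> (Suc a \<in> S) = d a}.
      (if c then insert a S else S) - {a} = S"
    by auto
qed

lemma ideal_count_step:
  assumes "a < b"
  shows "ideal_count d b a (d a) = ideal_count d b (Suc a) (d a)"
    and "ideal_count d b a (\<not> d a) = ideal_count d b (Suc a) (\<not> d a) + ideal_count d b (Suc a) (d a)"
proof -
  have "ideal_count d b a c = card {S \<in> ideals d (Suc a) b. c = d a \<longrightarrow> (Suc a \<in> S) = d a}" for c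
    unfolding ideal_count_def by (rule bij_betw_same_card[OF bij_betw_ideals_Suc[OF assms]])
  from this[of "d a"] this[of "\<not> d a"]
  show "ideal_count d b a (d a) = ideal_count d b (Suc a) (d a)"
    and "ideal_count d b a (\<not> d a) = ideal_count d b (Suc a) (\<not> d a) + ideal_count d b (Suc a) (d a)"
    using card_ideals[of d "Suc a" b "d a"] by (simp_all add: ideal_count_def[of d b "Suc a"])
qed

text \<open>Along the leg, the membership value \<open>c\<close> persists once it is taken. So a set
  with value \<open>\<not> c\<close> at \<open>a\<close> either keeps it up to \<open>e\<close> or
  switches to \<open>c\<close> at one of the \<open>e - a\<close> positions after
  \<open>a\<close>.\<close>

lemma ideal_count_leg:
  assumes "a \<le> e" "e \<le> b" "\<And>p. a \<le> p \<Longrightarrow> p < e \<Longrightarrow> d p = c"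
  shows "ideal_count d b a c = ideal_count d b e c"
    and "ideal_count d b a (\<not> c) = ideal_count d b e (\<not> c) + (e - a) * ideal_count d b e c"
proof -
  have "ideal_count d b p c = ideal_count d b e c \<and>
      ideal_count d b p (\<not> c) = ideal_count d b e (\<not> c) + (e - p) * ideal_count d b e c"
    if "p \<le> e" "a \<le> p" for p
    using that
  proof (induction p rule: inc_induct)
    case (step p)
    then have "d p = c" "p < b" using assms by auto
    moreover have "e - p = Suc (e - Suc p)" using step by simp
    ultimately show ?case using step.IH step.prems ideal_count_step[of p b d] by auto
  qed simp
  from this[of a] show "ideal_count d b a c = ideal_count d b e c"
    "ideal_count d b a (\<not> c) = ideal_count d b e (\<not> c) + (e - a) * ideal_count d b e c"
    using assms(1) by auto
qed

lemma card_ideals_legs: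
  assumes "sorted ps" "length ps = Suc (length ks)" "ps ! 0 = 0" "ps ! length ks = b"
    and ks: "\<And>i. i < length ks \<Longrightarrow> ks ! i = ps ! Suc i - ps ! i"
    and legs: "\<And>i p. i < length ks \<Longrightarrow> ps ! i \<le> p \<Longrightarrow> p < ps ! Suc i \<Longrightarrow> d p = (c = even i)"
  shows "card (ideals d 0 b) = fst (leg_counts ks) + snd (leg_counts ks)"
proof -
  \<comment> \<open>\<open>c = even i\<close> is the direction of the leg \<open>i\<close>, so the
    first component counts the sets whose membership at the left end of that leg disagrees with its
    direction. After the last leg a single position remains and both counts are 1.\<close>
  have "leg_counts (drop i ks) =
      (ideal_count d b (ps ! i) (\<not> (c = even i)), ideal_count d b (ps ! i) (c = even i))"
    if "i \<le> length ks" for i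
    using that
  proof (induction i rule: inc_induct)
    case base
    then show ?case using assms(4) by (simp add: ideal_count_last)
  next
    case (step i)
    have le: "ps ! i \<le> ps ! Suc i" "ps ! Suc i \<le> b"
      using assms(1,2,4) step(2) by (auto simp: sorted_iff_nth_mono)
    have "drop i ks = ks ! i # drop (Suc i) ks" using step(2) by (simp add: Cons_nth_drop_Suc)
    then show ?case
      using ideal_count_leg[OF le, of d "c = even i"] step legs[of i] ks[of i] by auto
  qed
  from this[of 0] show ?thesis using card_ideals[of d 0 b "\<not> c"] assms(3) by simp
qed

text \<open>Read from the left, the direction flips exactly at the inner elements of
  \<open>ps\<close>, that is, exactly where the index of the leg increases by 1.\<close>

lemma legs_alternate:
  assumes "sorted ps" "distinct ps" "length ps = Suc m"
    and "ps ! 0 = 0" "ps ! m = b"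
    and turn: "\<And>p. Suc p < b \<Longrightarrow> Suc p \<in> set ps \<longleftrightarrow> d (Suc p) \<noteq> d p"
    and "i < m" "ps ! i \<le> p" "p < ps ! Suc i"
  shows "d p = (d 0 = even i)"
  using assms(7-)
proof (induction p arbitrary: i)
  case 0
  then have "ps ! i = ps ! 0" using assms(4) by simp
  then have "i = 0" using assms(2,3) 0 by (simp add: nth_eq_iff_index_eq)
  then show ?case by simp
next
  case (Suc p)
  have mono: "ps ! j < ps ! k" if "j < k" "k \<le> m" for j k
    using sorted_wrt_nth_less[of "(<)" ps j k] assms(1-3) that by (simp add: strict_sorted_iff)
  have "ps ! Suc i \<le> b" using mono[of "Suc i" m] assms(5) Suc.prems by (cases "Suc i = m") auto
  then have lt: "Suc p < b" using Suc.prems by simp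
  show ?case
  proof (cases "ps ! i = Suc p")
    \<comment> \<open>Here \<open>Suc p\<close> is the left end of leg \<open>i\<close>, so
      \<open>p\<close> belongs to the preceding leg and the direction flips in between.\<close>
    case True
    then obtain j where j: "i = Suc j" using assms(4) by (cases i) auto
    have "d p = (d 0 = even j)" using Suc.IH[of j] Suc.prems True mono[of j i] j by auto
    moreover have "Suc p \<in> set ps" using True Suc.prems assms(3) by (metis less_Suc_eq nth_mem)
    ultimately show ?thesis using turn[OF lt] j by auto
  next
    case False
    have "Suc p \<notin> set ps"
    proof
      assume "Suc p \<in> set ps"
      then obtain j where j: "j \<le> m" "ps ! j = Suc p"
        using assms(3) by (auto simp: in_set_conv_nth less_Suc_eq_le)
      show False
        using mono[of j i] mono[of "Suc i" j] j False Suc.prems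
        by (cases "j < i"; cases "j = i"; cases "j = Suc i") auto
    qed
    then show ?thesis using turn[OF lt] Suc.IH[of i] Suc.prems False by auto
  qed
qed


section \<open>Submodules of string modules\<close>

text \<open>This collects what the endomorphism algebra contributes. The carrier of \<open>B\<close>
  is a subset of its type and the module laws hold on that subset only, hence the closure
  assumptions.\<close>

locale generated_module = vector_space scl
  for scl :: "'k::field \<Rightarrow> 'm::ab_group_add \<Rightarrow> 'm" +
  fixes B :: "('b::ab_group_add, 'k) kalg" and Q :: "('v, 'a) pre_digraph"
    and e :: "'v \<Rightarrow> 'b" and val :: "'a \<Rightarrow> 'b" and act :: "'b \<Rightarrow> 'm \<Rightarrow> 'm"
  assumes zero_mem: "0 \<in> acar B"
    and add_mem: "f \<in> acar B \<Longrightarrow> g \<in> acar B \<Longrightarrow> f + g \<in> acar B"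
    and ascl_mem: "f \<in> acar B \<Longrightarrow> ascl B c f \<in> acar B"
    and amul_mem: "f \<in> acar B \<Longrightarrow> g \<in> acar B \<Longrightarrow> amul B f g \<in> acar B"
    and idem_mem: "u \<in> verts Q \<Longrightarrow> e u \<in> acar B"
    and idem_orth: "u \<in> verts Q \<Longrightarrow> v \<in> verts Q \<Longrightarrow> amul B (e u) (e v) = (if u = v then e u else 0)"
    and presentation: "bound_quiver_presentation B Q e val"
    and left_module: "left_module B scl act"
begin

section \<open>The action and its generation by idempotents and arrows\<close>

lemma act_vec_add: "g \<in> acar B \<Longrightarrow> act g (y + z) = act g y + act g z"
  and act_vec_scale: "g \<in> acar B \<Longrightarrow> act g (scl c y) = scl c (act g y)"
  using left_module unfolding left_module_def
  by (simp_all add: Vector_Spaces.linear_iff)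

lemma act_vec_zero: "g \<in> acar B \<Longrightarrow> act g 0 = 0"
  using act_vec_add[of g 0 0] by simp

lemma act_add: "f \<in> acar B \<Longrightarrow> g \<in> acar B \<Longrightarrow> act (f + g) y = act f y + act g y"
  and act_ascl: "f \<in> acar B \<Longrightarrow> act (ascl B c f) y = scl c (act f y)"
  and act_amul: "f \<in> acar B \<Longrightarrow> g \<in> acar B \<Longrightarrow> act (amul B f g) y = act f (act g y)"
  using left_module unfolding left_module_def by blast+

lemma act_zero: "act 0 y = 0"
  using act_add[OF zero_mem zero_mem, of y] by simp

lemma act_sum:
  assumes "finite K" "\<And>i. i \<in> K \<Longrightarrow> f i \<in> acar B"
  shows "sum f K \<in> acar B" "act (sum f K) y = (\<Sum>i\<in>K. act (f i) y)"
proof -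
  have "sum f K \<in> acar B \<and> act (sum f K) y = (\<Sum>i\<in>K. act (f i) y)"
    using assms by (induction K) (auto simp: zero_mem act_zero add_mem act_add)
  then show "sum f K \<in> acar B" "act (sum f K) y = (\<Sum>i\<in>K. act (f i) y)" by auto
qed

lemma act_idem_idem:
  assumes "u \<in> verts Q" "v \<in> verts Q"
  shows "act (e u) (act (e v) y) = (if u = v then act (e u) y else 0)"
  using assms by (simp add: act_amul[symmetric] idem_mem idem_orth act_zero)

lemma val_mem: "a \<in> arcs Q \<Longrightarrow> val a \<in> acar B"
  using presentation unfolding bound_quiver_presentation_def by blast

lemma head_mem: "a \<in> arcs Q \<Longrightarrow> head Q a \<in> verts Q"
  using presentation wf_digraph.head_in_verts
  unfolding bound_quiver_presentation_def fin_digraph_def by fast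

text \<open>The first arrow of a path acts first, so the induction passes from \<open>y\<close> to
  its image under that arrow. Membership in \<open>acar B\<close> is carried along because
  \<open>act_amul\<close> requires it.\<close>

lemma path_value_stable:
  assumes "subspace N"
    and "\<And>u y. u \<in> verts Q \<Longrightarrow> y \<in> N \<Longrightarrow> act (e u) y \<in> N"
    and "\<And>a y. a \<in> arcs Q \<Longrightarrow> y \<in> N \<Longrightarrow> act (val a) y \<in> N"
    and "u \<in> verts Q" "set p \<subseteq> arcs Q" "y \<in> N"
  shows "path_value B Q e val u p \<in> acar B \<and> act (path_value B Q e val u p) y \<in> N"
  using assms(4-)
proof (induction p arbitrary: u y)
  case Nil
  then show ?case using assms(2) idem_mem by simp
next
  case (Cons a p)
  then have a: "a \<in> arcs Q" by simp
  have "path_value B Q e val (head Q a) p \<in> acar B \<and>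
      act (path_value B Q e val (head Q a) p) (act (val a) y) \<in> N"
    using Cons.prems a by (intro Cons.IH head_mem assms(3)) auto
  then show ?case by (simp add: act_amul amul_mem val_mem a)
qed

text \<open>The map from the path algebra onto \<open>B\<close> is surjective, so every element of
  \<open>B\<close> acts as a linear combination of paths.\<close>

lemma submodule_iff:
  "submodule B scl act N \<longleftrightarrow> subspace N \<and>
     (\<forall>u\<in>verts Q. \<forall>y\<in>N. act (e u) y \<in> N) \<and> (\<forall>a\<in>arcs Q. \<forall>y\<in>N. act (val a) y \<in> N)"
proof
  assume r: "subspace N \<and>
     (\<forall>u\<in>verts Q. \<forall>y\<in>N. act (e u) y \<in> N) \<and> (\<forall>a\<in>arcs Q. \<forall>y\<in>N. act (val a) y \<in> N)"
  have "act g y \<in> N" if g: "g \<in> acar B" and y: "y \<in> N" for g y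
  proof -
    obtain c where c: "c \<in> path_algebra Q" "g = path_algebra_hom B Q e val c"
      using presentation g unfolding bound_quiver_presentation_def by blast
    let ?K = "Poly_Mapping.keys c" and ?v = "\<lambda>up. path_value B Q e val (fst up) (snd up)"
    have v: "?v up \<in> acar B \<and> act (?v up) y \<in> N" if "up \<in> ?K" for up
    proof -
      have "case up of (u, p) \<Rightarrow> \<exists>v. pre_digraph.awalk Q u p v"
        using c(1) that unfolding path_algebra_def by (elim CollectE bspec)
      then obtain v where "pre_digraph.awalk Q (fst up) (snd up) v"
        unfolding case_prod_unfold by (elim exE)
      then show ?thesis
        using r y by (intro path_value_stable) (auto simp: pre_digraph.awalk_def)
    qed
    have "g = (\<Sum>up\<in>?K. ascl B (Poly_Mapping.lookup c up) (?v up))"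
      unfolding c(2) path_algebra_hom_def by (intro sum.cong) auto
    then have "act g y = (\<Sum>up\<in>?K. scl (Poly_Mapping.lookup c up) (act (?v up) y))"
      using v by (simp add: act_sum ascl_mem act_ascl)
    also have "\<dots> \<in> N" using v r by (intro subspace_sum subspace_scale) auto
    finally show ?thesis .
  qed
  with r show "submodule B scl act N" unfolding submodule_def by blast
qed (auto simp: submodule_def idem_mem val_mem)

end

text \<open>The basis hidden in \<open>is_string_module\<close> becomes a parameter, and its
  positions range over \<open>{0..length as}\<close> to agree with \<open>ideals\<close>.\<close>

locale string_module = generated_module scl B Q e val act
  for scl :: "'k::field \<Rightarrow> 'm::ab_group_add \<Rightarrow> 'm"
    and B :: "('b::ab_group_add, 'k) kalg" and Q :: "('v, 'a) pre_digraph"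
    and e :: "'v \<Rightarrow> 'b" and val :: "'a \<Rightarrow> 'b" and act :: "'b \<Rightarrow> 'm \<Rightarrow> 'm" +
  fixes vs :: "'v list" and as :: "'a list" and x :: "nat \<Rightarrow> 'm"
  assumes string: "is_string Q vs as"
    and inj_x: "inj_on x {0..length as}"
    and independent_x: "independent (x ` {0..length as})"
    and span_x: "span (x ` {0..length as}) = UNIV"
    and act_idem_x: "p \<le> length as \<Longrightarrow> act (e (vs ! p)) (x p) = x p"
    and act_val_x: "a \<in> arcs Q \<Longrightarrow> p \<le> length as \<Longrightarrow> act (val a) (x p) =
           (if p < length as \<and> as ! p = a \<and> tail Q a = vs ! p then x (Suc p)
            else if 0 < p \<and> as ! (p - 1) = a \<and> tail Q a = vs ! p then x (p - 1)
            else 0)"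
begin

section \<open>The basis of a string module\<close>

abbreviation len :: nat where "len \<equiv> length as"

definition right :: "nat \<Rightarrow> bool" where
  "right p \<longleftrightarrow> tail Q (as ! p) = vs ! p"

abbreviation position_span :: "nat set \<Rightarrow> 'm set" where
  "position_span S \<equiv> span (x ` S)"

definition support :: "'m set \<Rightarrow> nat set" where
  "support N = {p. p \<le> len \<and> x p \<in> N}"

lemma length_vs: "length vs = Suc len"
  using string unfolding is_string_def by blast

lemma vs_mem: "p \<le> len \<Longrightarrow> vs ! p \<in> verts Q"
  using string length_vs unfolding is_string_def by (auto simp: less_Suc_eq_le)

lemma vs_eq_iff: "p \<le> len \<Longrightarrow> q \<le> len \<Longrightarrow> vs ! p = vs ! q \<longleftrightarrow> p = q"
  using string length_vs unfolding is_string_def by (simp add: nth_eq_iff_index_eq)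

lemma as_mem: "p < len \<Longrightarrow> as ! p \<in> arcs Q"
  and as_ends: "p < len \<Longrightarrow> {tail Q (as ! p), head Q (as ! p)} = {vs ! p, vs ! Suc p}"
  using string unfolding is_string_def by blast+

lemma tail_left:
  assumes "p < len" "\<not> right p"
  shows "tail Q (as ! p) = vs ! Suc p"
  using as_ends[OF assms(1)] assms(2) unfolding right_def by blast

text \<open>The vertices are distinct, so the pair of ends of an arrow determines its place in the
  string.\<close>

lemma as_nth_eq:
  assumes "p < len" "q < len" "as ! p = as ! q"
  shows "p = q"
proof -
  have "{vs ! p, vs ! Suc p} = {vs ! q, vs ! Suc q}"
    using as_ends[OF assms(1)] as_ends[OF assms(2)] assms(3) by simp
  then have "(vs ! p = vs ! q \<or> vs ! p = vs ! Suc q) \<and>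
      (vs ! Suc p = vs ! q \<or> vs ! Suc p = vs ! Suc q)"
    by blast
  then show ?thesis using assms(1,2) by (auto simp: vs_eq_iff)
qed

lemma act_right:
  assumes "p < len" "right p"
  shows "act (val (as ! p)) (x p) = x (Suc p)"
  using act_val_x[OF as_mem[OF assms(1)], of p] assms unfolding right_def by simp

lemma act_left:
  assumes "p < len" "\<not> right p"
  shows "act (val (as ! p)) (x (Suc p)) = x p"
proof -
  \<comment> \<open>Otherwise the first case of \<open>act_val_x\<close> would apply and move
    \<open>x (Suc p)\<close> to the right.\<close>
  have "as ! Suc p \<noteq> as ! p" if "Suc p < len" using as_nth_eq[of "Suc p" p] that assms by auto
  then show ?thesis
    using act_val_x[OF as_mem[OF assms(1)], of "Suc p"] assms tail_left[OF assms] by auto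
qed

lemma x_mem_position_span:
  assumes "S \<subseteq> {0..len}" "p \<le> len"
  shows "x p \<in> position_span S \<longleftrightarrow> p \<in> S"
proof
  assume mem: "x p \<in> position_span S"
  show "p \<in> S"
  proof (rule ccontr)
    assume "p \<notin> S"
    then have "x ` S \<subseteq> x ` {0..len} - {x p}"
      using assms inj_onD[OF inj_x] by (fastforce simp: subset_iff)
    then have "x p \<in> span (x ` {0..len} - {x p})" using mem span_mono by blast
    then show False using independent_x assms(2) unfolding dependent_def by auto
  qed
qed (simp add: span_base)

lemma position_span_subset_iff:
  assumes "S \<subseteq> {0..len}" "T \<subseteq> {0..len}"
  shows "position_span S \<subseteq> position_span T \<longleftrightarrow> S \<subseteq> T"
proof
  assume sub: "position_span S \<subseteq> position_span T"
  show "S \<subseteq> T"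
  proof
    fix p assume "p \<in> S"
    then have "p \<le> len" "x p \<in> position_span T" using assms sub span_base[of "x p"] by auto
    then show "p \<in> T" using x_mem_position_span assms by blast
  qed
qed (intro span_mono image_mono)

lemma position_span_eq_iff:
  assumes "S \<subseteq> {0..len}" "T \<subseteq> {0..len}"
  shows "position_span S = position_span T \<longleftrightarrow> S = T"
  using position_span_subset_iff[OF assms] position_span_subset_iff[OF assms(2,1)] by blast

lemma act_position_span:
  assumes "g \<in> acar B" "subspace N" "\<And>p. p \<in> S \<Longrightarrow> act g (x p) \<in> N" "y \<in> position_span S"
  shows "act g y \<in> N"
proof -
  have "subspace {y. act g y \<in> N}"
    using assms(2) unfolding subspace_def by (simp add: act_vec_add act_vec_scale act_vec_zero assms(1))
  then have "position_span S \<subseteq> {y. act g y \<in> N}" using assms(3) by (intro span_minimal) auto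
  with assms(4) show ?thesis by blast
qed

lemma act_idem_position:
  assumes "u \<in> verts Q" "p \<le> len"
  shows "act (e u) (x p) = (if u = vs ! p then x p else 0)"
  using act_idem_idem[OF assms(1) vs_mem[OF assms(2)], of "x p"] act_idem_x[OF assms(2)] by auto

text \<open>The component at each vertex of the string is a line: the idempotent fixes
  \<open>x p\<close> and kills the other basis vectors.\<close>

lemma act_idem_multiple:
  assumes "p \<le> len"
  obtains c where "act (e (vs ! p)) y = scl c (x p)"
proof -
  have "act (e (vs ! p)) y \<in> span {x p}"
    by (rule act_position_span[of _ _ "{0..len}"])
      (auto simp: span_x idem_mem vs_mem assms act_idem_position vs_eq_iff span_base span_zero)
  with that show thesis by (auto simp: span_singleton)
qed

lemma act_idem_eq_0:
  assumes "u \<in> verts Q" "S \<subseteq> {0..len}" "u \<notin> (!) vs ` S" "y \<in> position_span S"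
  shows "act (e u) y = 0"
  using act_position_span[of "e u" "{0}" S y] assms
  by (auto simp: idem_mem act_idem_position image_iff subset_iff)

lemma sum_act_idem: "(\<Sum>p\<in>{0..len}. act (e (vs ! p)) y) = y"
proof -
  let ?f = "\<lambda>y. \<Sum>p\<in>{0..len}. act (e (vs ! p)) y"
  have mem: "e (vs ! p) \<in> acar B" if "p \<in> {0..len}" for p using that by (simp add: idem_mem vs_mem)
  have "subspace {y. ?f y = y}"
    unfolding subspace_def
    by (simp add: mem act_vec_add act_vec_scale act_vec_zero sum.distrib flip: scale_sum_right)
  moreover have "?f (x q) = x q" if "q \<le> len" for q
  proof -
    have "?f (x q) = (\<Sum>p\<in>{0..len}. if p = q then x q else 0)"
      using that by (intro sum.cong) (auto simp: act_idem_position vs_mem vs_eq_iff)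
    then show ?thesis using that by simp
  qed
  ultimately have "position_span {0..len} \<subseteq> {y. ?f y = y}" by (intro span_minimal) auto
  then show ?thesis using span_x by blast
qed

section \<open>Submodules as spans of closed sets of positions\<close>

lemma submodule_position_span:
  assumes S: "S \<in> ideals right 0 len"
  shows "submodule B scl act (position_span S)"
  unfolding submodule_iff
proof (intro conjI ballI)
  note sub = ideals_subset[OF S]
  fix u y assume u: "u \<in> verts Q" and y: "y \<in> position_span S"
  show "act (e u) y \<in> position_span S"
    using sub by (intro act_position_span[OF _ _ _ y])
      (auto simp: idem_mem u act_idem_position span_base span_zero)
next
  note sub = ideals_subset[OF S]
  fix a y assume a: "a \<in> arcs Q" and y: "y \<in> position_span S"
  show "act (val a) y \<in> position_span S"
  proof (intro act_position_span[OF _ _ _ y])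
    fix p assume p: "p \<in> S"
    then have le: "p \<le> len" using sub by auto
    \<comment> \<open>An arrow moves \<open>x p\<close> to a neighbour along the string or kills it;
      the two moves are the ones under which \<open>S\<close> is closed.\<close>
    consider "p < len" "right p" "act (val a) (x p) = x (Suc p)"
      | q where "p = Suc q" "\<not> right q" "act (val a) (x p) = x q"
      | "act (val a) (x p) = 0"
    proof (cases "p < len \<and> as ! p = a \<and> tail Q a = vs ! p")
      case True
      then show ?thesis using that(1) act_val_x[OF a le] unfolding right_def by auto
    next
      case False
      show ?thesis
      proof (cases "0 < p \<and> as ! (p - 1) = a \<and> tail Q a = vs ! p")
        case True
        then obtain q where q: "p = Suc q" by (cases p) auto
        then have "\<not> right q" using True le vs_eq_iff[of p q] unfolding right_def by auto
        then show ?thesis using that(2)[OF q] act_val_x[OF a le] False True q by auto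
      next
        case False
        then show ?thesis using that(3) act_val_x[OF a le] \<open>\<not> (p < len \<and> _)\<close> by auto
      qed
    qed
    then show "act (val a) (x p) \<in> position_span S"
    proof cases
      case 1
      then show ?thesis using idealsD(1)[OF S p] by (simp add: span_base)
    next
      case 2
      then show ?thesis using idealsD(2)[OF S, of q] p by (simp add: span_base)
    qed (simp add: span_zero)
  qed (auto simp: val_mem a)
qed auto

text \<open>An element of \<open>N\<close> is the sum of its components at the vertices. These lie
  in \<open>N\<close> and are multiples of basis vectors, and a nonzero multiple puts the basis
  vector itself into \<open>N\<close>.\<close>

lemma support_submodule:
  assumes N: "submodule B scl act N"
  shows "support N \<in> ideals right 0 len" "N = position_span (support N)"
proof -
  have sub: "subspace N" and idem: "\<And>u y. u \<in> verts Q \<Longrightarrow> y \<in> N \<Longrightarrow> act (e u) y \<in> N"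
    and arr: "\<And>a y. a \<in> arcs Q \<Longrightarrow> y \<in> N \<Longrightarrow> act (val a) y \<in> N"
    using N unfolding submodule_iff by blast+
  have "if right p then p \<in> support N \<longrightarrow> Suc p \<in> support N else Suc p \<in> support N \<longrightarrow> p \<in> support N"
    if "p < len" for p
    using arr[OF as_mem[OF that], of "x p"] arr[OF as_mem[OF that], of "x (Suc p)"]
      act_right[OF that] act_left[OF that] that unfolding support_def by auto
  then show "support N \<in> ideals right 0 len"
    unfolding ideals_def mem_Collect_eq by (force simp: support_def)
  show "N = position_span (support N)"
  proof (intro equalityI subsetI)
    fix y assume y: "y \<in> N"
    have "act (e (vs ! p)) y \<in> position_span (support N)" if p: "p \<le> len" for p
    proof -
      obtain c where c: "act (e (vs ! p)) y = scl c (x p)" using act_idem_multiple[OF p] .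
      show ?thesis
      proof (cases "c = 0")
        case False
        have "scl (inverse c) (scl c (x p)) \<in> N"
          using subspace_scale[OF sub idem[OF vs_mem[OF p] y], of "inverse c"] by (simp only: c)
        then have "p \<in> support N" using False p unfolding support_def by simp
        then show ?thesis unfolding c by (intro span_scale span_base) auto
      qed (simp add: c span_zero)
    qed
    then have "(\<Sum>p\<in>{0..len}. act (e (vs ! p)) y) \<in> position_span (support N)"
      by (intro span_sum) auto
    then show "y \<in> position_span (support N)" unfolding sum_act_idem .
  next
    fix y assume "y \<in> position_span (support N)"
    moreover have "position_span (support N) \<subseteq> N"
      using sub by (intro span_minimal) (auto simp: support_def)
    ultimately show "y \<in> N" by blast
  qed
qed

lemma submodules_eq: "{N. submodule B scl act N} = position_span ` ideals right 0 len"
  using submodule_position_span support_submodule by blast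

lemma submoduleE:
  assumes "submodule B scl act N"
  obtains S where "S \<in> ideals right 0 len" "S \<subseteq> {0..len}" "N = position_span S"
  using support_submodule[OF assms] ideals_subset that by blast

lemma card_submodules: "card {N. submodule B scl act N} = card (ideals right 0 len)"
  unfolding submodules_eq
  by (intro card_image inj_onI) (metis ideals_subset position_span_eq_iff)

end

text \<open>The right-hand side says that \<open>p\<close> is a sink. The left neighbour is written
  through \<open>p = Suc q\<close>, so that position 0 has none.\<close>

lemma singleton_mem_ideals_iff:
  assumes "p \<le> b"
  shows "{p} \<in> ideals d 0 b \<longleftrightarrow> (p < b \<longrightarrow> \<not> d p) \<and> (\<forall>q. p = Suc q \<longrightarrow> d q)"
proof
  assume S: "{p} \<in> ideals d 0 b"
  show "(p < b \<longrightarrow> \<not> d p) \<and> (\<forall>q. p = Suc q \<longrightarrow> d q)"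
    using idealsD(1)[OF S, of p] idealsD(2)[OF S] by auto
qed (use assms in \<open>auto simp: ideals_def\<close>)

text \<open>Dually, \<open>p\<close> has to be a source: an arrow into \<open>p\<close> would start
  in the complement and leave it.\<close>

lemma remove1_mem_ideals_iff:
  assumes "p \<le> b"
  shows "{0..b} - {p} \<in> ideals d 0 b \<longleftrightarrow> (p < b \<longrightarrow> d p) \<and> (\<forall>q. p = Suc q \<longrightarrow> \<not> d q)"
proof
  assume S: "{0..b} - {p} \<in> ideals d 0 b"
  show "(p < b \<longrightarrow> d p) \<and> (\<forall>q. p = Suc q \<longrightarrow> \<not> d q)"
  proof (intro conjI impI allI)
    assume "p < b"
    then show "d p" using idealsD(2)[OF S, of p] by auto
  next
    fix q assume "p = Suc q"
    then show "\<not> d q" using idealsD(1)[OF S, of q] assms by auto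
  qed
qed (use assms in \<open>auto simp: ideals_def\<close>)

section \<open>Peaks, valleys and composition length in terms of positions\<close>

context string_module
begin

lemma x_nonzero: "p \<le> len \<Longrightarrow> x p \<noteq> 0"
  using x_mem_position_span[of "{}" p] by auto

lemma composition_factor_iff:
  assumes S: "S \<subseteq> {0..len}" and v: "v \<in> verts Q"
  shows "composition_factor e act (position_span S) {0} v \<longleftrightarrow> v \<in> (!) vs ` S"
proof
  assume "composition_factor e act (position_span S) {0} v"
  then show "v \<in> (!) vs ` S"
    using act_idem_eq_0[OF v S] unfolding composition_factor_def by blast
next
  assume "v \<in> (!) vs ` S"
  then obtain p where p: "p \<in> S" "v = vs ! p" by blast
  then have le: "p \<le> len" using S by auto
  then have "act (e v) (x p) \<notin> {0}" using act_idem_x p(2) x_nonzero by auto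
  then show "composition_factor e act (position_span S) {0} v"
    unfolding composition_factor_def using p(1) by (blast intro: span_base)
qed

text \<open>By \<open>ideal_insert\<close>, applied to the empty set, every nonempty closed set
  contains a closed singleton.\<close>

lemma simple_submodule_iff:
  "simple_submodule B scl act N \<longleftrightarrow> (\<exists>p. {p} \<in> ideals right 0 len \<and> N = position_span {p})"
proof
  assume simple: "simple_submodule B scl act N"
  then have "submodule B scl act N" unfolding simple_submodule_def by blast
  then obtain S where S: "S \<in> ideals right 0 len" "S \<subseteq> {0..len}" "N = position_span S"
    by (rule submoduleE)
  have "S \<noteq> {}" using simple S(3) unfolding simple_submodule_def by auto
  then obtain p where p: "p \<in> S" "{p} \<in> ideals right 0 len"
    using ideal_insert[OF empty_mem_ideals S(1)] by blast
  have sub: "position_span {p} \<subseteq> N" unfolding S(3) using p(1) by (intro span_mono) auto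
  have "p \<le> len" using p(1) S(2) by auto
  then have "position_span {p} \<noteq> {0}" using x_nonzero[of p] span_base[of "x p" "x ` {p}"] by auto
  then have "position_span {p} = N"
    using simple sub submodule_position_span[OF p(2)] unfolding simple_submodule_def by metis
  with p(2) show "\<exists>p. {p} \<in> ideals right 0 len \<and> N = position_span {p}" by metis
next
  assume "\<exists>p. {p} \<in> ideals right 0 len \<and> N = position_span {p}"
  then obtain p where p: "{p} \<in> ideals right 0 len" "N = position_span {p}" by blast
  note sub = ideals_subset[OF p(1)]
  show "simple_submodule B scl act N" unfolding simple_submodule_def
  proof (intro conjI allI impI)
    show "submodule B scl act N" unfolding p(2) by (rule submodule_position_span[OF p(1)])
    show "N \<noteq> {0}" using x_nonzero[of p] sub span_base[of "x p" "x ` {p}"] unfolding p(2) by auto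
    fix N' assume N': "submodule B scl act N' \<and> N' \<subseteq> N"
    then obtain S where S: "S \<subseteq> {0..len}" "N' = position_span S" by (blast elim: submoduleE)
    then have "S \<subseteq> {p}" using N' position_span_subset_iff[OF S(1) sub] p(2) by auto
    then have "S = {} \<or> S = {p}" by blast
    then show "N' = {0} \<or> N' = N" unfolding S(2) p(2) by auto
  qed
qed

text \<open>The socle is spanned by the basis vectors at the sinks.\<close>

lemma valley_iff:
  assumes "p \<le> len"
  shows "valley B e scl act (vs ! p) \<longleftrightarrow> {p} \<in> ideals right 0 len"
proof -
  let ?S = "{p. {p} \<in> ideals right 0 len}"
  have S: "?S \<subseteq> {0..len}" using ideals_subset by blast
  have "socle B scl act = position_span ?S"
  proof
    have "N \<subseteq> position_span ?S" if "simple_submodule B scl act N" for N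
    proof -
      from that obtain q where "{q} \<in> ideals right 0 len" "N = position_span {q}"
        unfolding simple_submodule_iff by blast
      then show ?thesis by (simp only:) (intro span_mono image_mono, blast)
    qed
    then show "socle B scl act \<subseteq> position_span ?S"
      unfolding socle_def by (intro span_minimal) auto
    have "x ` ?S \<subseteq> \<Union> {N. simple_submodule B scl act N}"
    proof (rule image_subsetI)
      fix q assume "q \<in> ?S"
      then have "simple_submodule B scl act (position_span {q})" using simple_submodule_iff by blast
      moreover have "x q \<in> position_span {q}" by (intro span_base) auto
      ultimately show "x q \<in> \<Union> {N. simple_submodule B scl act N}" by blast
    qed
    then show "position_span ?S \<subseteq> socle B scl act" unfolding socle_def by (rule span_mono)
  qed
  then have "valley B e scl act (vs ! p) \<longleftrightarrow> vs ! p \<in> (!) vs ` ?S"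
    unfolding valley_def using composition_factor_iff[OF S vs_mem[OF assms]] by simp
  also have "\<dots> \<longleftrightarrow> p \<in> ?S" using assms S vs_eq_iff by (auto simp: image_iff subset_iff)
  finally show ?thesis by simp
qed

text \<open>By \<open>ideal_remove\<close>, applied to the full set of positions, every proper
  closed set lies in one that omits a single position.\<close>

lemma maximal_submodule_iff:
  "maximal_submodule B scl act N \<longleftrightarrow>
     (\<exists>p\<le>len. {0..len} - {p} \<in> ideals right 0 len \<and> N = position_span ({0..len} - {p}))"
proof
  assume maxi: "maximal_submodule B scl act N"
  then have "submodule B scl act N" unfolding maximal_submodule_def by blast
  then obtain S where S: "S \<in> ideals right 0 len" "S \<subseteq> {0..len}" "N = position_span S"
    by (rule submoduleE)
  have "S \<noteq> {0..len}"
    using maxi S(3) span_x unfolding maximal_submodule_def by auto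
  then have "S \<subset> {0..len}" using S(2) by blast
  then obtain p where p: "p \<in> {0..len} - S" "{0..len} - {p} \<in> ideals right 0 len"
    using ideal_remove[OF S(1) atLeastAtMost_mem_ideals] by blast
  have sub: "N \<subseteq> position_span ({0..len} - {p})"
    unfolding S(3) using p(1) S(2) by (intro span_mono) auto
  have "x p \<notin> position_span ({0..len} - {p})" using p(1) by (subst x_mem_position_span) auto
  then have "position_span ({0..len} - {p}) \<noteq> UNIV" by blast
  then have "position_span ({0..len} - {p}) = N"
    using maxi sub submodule_position_span[OF p(2)] unfolding maximal_submodule_def by metis
  with p show "\<exists>p\<le>len. {0..len} - {p} \<in> ideals right 0 len \<and> N = position_span ({0..len} - {p})"
    by auto
next
  assume "\<exists>p\<le>len. {0..len} - {p} \<in> ideals right 0 len \<and> N = position_span ({0..len} - {p})"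
  then obtain p where p: "p \<le> len" "{0..len} - {p} \<in> ideals right 0 len"
    "N = position_span ({0..len} - {p})" by blast
  show "maximal_submodule B scl act N" unfolding maximal_submodule_def
  proof (intro conjI allI impI)
    show "submodule B scl act N" unfolding p(3) by (rule submodule_position_span[OF p(2)])
    have "x p \<notin> N" unfolding p(3) using p(1) by (subst x_mem_position_span) auto
    then show "N \<noteq> UNIV" by blast
    fix N' assume N': "submodule B scl act N' \<and> N \<subseteq> N'"
    then obtain S where S: "S \<subseteq> {0..len}" "N' = position_span S" by (blast elim: submoduleE)
    then have "{0..len} - {p} \<subseteq> S"
      using N' position_span_subset_iff[OF _ S(1), of "{0..len} - {p}"] p(3) by auto
    then have "S = {0..len} - {p} \<or> S = {0..len}" using S(1) by blast
    then show "N' = N \<or> N' = UNIV" unfolding S(2) p(3) using span_x by metis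
  qed
qed

text \<open>At a source, the maximal submodule that omits \<open>p\<close> keeps \<open>x p\<close>
  out of the radical. At any other position every maximal submodule omits a different basis vector,
  so it contains the whole component at \<open>vs ! p\<close>.\<close>

lemma peak_iff:
  assumes "p \<le> len"
  shows "peak B e scl act (vs ! p) \<longleftrightarrow> {0..len} - {p} \<in> ideals right 0 len"
proof
  assume S: "{0..len} - {p} \<in> ideals right 0 len"
  have "x p \<notin> position_span ({0..len} - {p})" using assms by (subst x_mem_position_span) auto
  moreover have "maximal_submodule B scl act (position_span ({0..len} - {p}))"
    using S assms maximal_submodule_iff by blast
  ultimately have "x p \<notin> radical B scl act" unfolding radical_def by blast
  then show "peak B e scl act (vs ! p)"
    unfolding peak_def composition_factor_def using act_idem_x[OF assms] by (metis UNIV_I)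
next
  assume peak: "peak B e scl act (vs ! p)"
  show "{0..len} - {p} \<in> ideals right 0 len"
  proof (rule ccontr)
    assume S: "{0..len} - {p} \<notin> ideals right 0 len"
    have "act (e (vs ! p)) y \<in> N" if N: "maximal_submodule B scl act N" for y N
    proof -
      obtain q where q: "{0..len} - {q} \<in> ideals right 0 len" "N = position_span ({0..len} - {q})"
        using N maximal_submodule_iff by blast
      obtain c where "act (e (vs ! p)) y = scl c (x p)" using act_idem_multiple[OF assms] .
      moreover have "x p \<in> N" unfolding q(2) using S q(1) assms by (intro span_base) auto
      ultimately show ?thesis unfolding q(2) by (simp add: span_scale)
    qed
    then show False using peak unfolding peak_def composition_factor_def radical_def by blast
  qed
qed

text \<open>Along a composition series the supports grow by exactly one position: if a step added
  more, \<open>ideal_insert\<close> would produce a submodule strictly in between.\<close>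

lemma composition_length_eq_card:
  assumes S: "S \<in> ideals right 0 len" and l: "has_composition_length B scl act (position_span S) l"
  shows "l = card S"
proof -
  obtain Ns where series: "Ns 0 = {0} \<and> Ns l = position_span S \<and>
        (\<forall>i\<le>l. submodule B scl act (Ns i)) \<and>
        (\<forall>i<l. Ns i \<subset> Ns (Suc i) \<and>
           \<not> (\<exists>K. submodule B scl act K \<and> Ns i \<subset> K \<and> K \<subset> Ns (Suc i)))"
    using l unfolding has_composition_length_def by (elim exE)
  then have Ns: "Ns 0 = {0}" "Ns l = position_span S"
    and sub: "\<And>i. i \<le> l \<Longrightarrow> submodule B scl act (Ns i)"
    and less: "\<And>i. i < l \<Longrightarrow> Ns i \<subset> Ns (Suc i)"
    and cover: "\<And>i K. i < l \<Longrightarrow> submodule B scl act K \<Longrightarrow> Ns i \<subset> K \<Longrightarrow> \<not> K \<subset> Ns (Suc i)"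
    by simp_all
  have T: "support (Ns i) \<in> ideals right 0 len" "Ns i = position_span (support (Ns i))"
    if "i \<le> l" for i
    using support_submodule[OF sub[OF that]] by blast+
  have "card (support (Ns i)) = i" if "i \<le> l" for i
    using that
  proof (induction i)
    case 0
    then show ?case using x_nonzero by (auto simp: support_def Ns(1))
  next
    case (Suc i)
    let ?S = "support (Ns i)" and ?T = "support (Ns (Suc i))"
    have i: "i < l" "i \<le> l" using Suc.prems by auto
    note S = T[OF i(2)] and T = T[OF Suc.prems]
    have subs: "?S \<subseteq> {0..len}" "?T \<subseteq> {0..len}" using ideals_subset[OF S(1)] ideals_subset[OF T(1)] .
    have "position_span ?S \<subset> position_span ?T" using less[OF i(1)] S(2) T(2) by auto
    then have "?S \<subset> ?T"
      using position_span_subset_iff[OF subs] position_span_subset_iff[OF subs(2,1)] by blast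
    then obtain p where p: "p \<in> ?T - ?S" "insert p ?S \<in> ideals right 0 len"
      using ideal_insert[OF S(1) T(1)] by blast
    let ?K = "position_span (insert p ?S)"
    have subs': "insert p ?S \<subseteq> {0..len}" using ideals_subset[OF p(2)] .
    have "Ns i \<subset> ?K"
      using position_span_subset_iff[OF subs(1) subs'] position_span_subset_iff[OF subs' subs(1)] p(1)
        S(2) by blast
    then have "\<not> ?K \<subset> Ns (Suc i)" using cover[OF i(1)] submodule_position_span[OF p(2)] by blast
    moreover have "?K \<subseteq> Ns (Suc i)"
      using position_span_subset_iff[OF subs' subs(2)] p(1) \<open>?S \<subset> ?T\<close> T(2) by blast
    ultimately have "?K = position_span ?T" using T(2) by blast
    then have "insert p ?S = ?T" using position_span_eq_iff[OF subs' subs(2)] by blast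
    moreover have "finite ?S" using subs(1) finite_subset by blast
    ultimately show ?case using Suc.IH[OF i(2)] p(1) by (metis DiffD2 card_insert_disjoint)
  qed
  then have "card (support (Ns l)) = l" by blast
  moreover have "support (Ns l) = S"
    using T[of l] Ns(2) position_span_eq_iff ideals_subset S by (metis order_refl)
  ultimately show ?thesis by simp
qed

text \<open>The data of \<open>has_shape\<close> are translated into positions: \<open>ps\<close>
  lists the sources and sinks, and each entry of \<open>ks\<close> is the distance between two
  neighbours in \<open>ps\<close>. The count by legs then applies.\<close>

lemma card_submodules_of_shape:
  assumes sorted: "sorted ps" and dist: "if length vs = 1 then length ps = 2 else distinct ps"
    and set_ps: "set ps = {p. p < length vs \<and>
          (peak B e scl act (vs ! p) \<or> valley B e scl act (vs ! p))}"
    and length_ps: "length ps = Suc (length ks)"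
    and legs: "\<forall>i<length ks. \<exists>N. uniserial B scl act N \<and>
           {v \<in> verts Q. composition_factor e act N {0} v} =
             {vs ! p |p. ps ! i \<le> p \<and> p \<le> ps ! Suc i \<and> \<not> peak B e scl act (vs ! p)} \<and>
           has_composition_length B scl act N (ks ! i)"
  shows "card {N. submodule B scl act N} = fst (leg_counts ks) + snd (leg_counts ks)"
proof -
  let ?source = "\<lambda>p. (p < len \<longrightarrow> right p) \<and> (\<forall>q. p = Suc q \<longrightarrow> \<not> right q)"
  let ?sink = "\<lambda>p. (p < len \<longrightarrow> \<not> right p) \<and> (\<forall>q. p = Suc q \<longrightarrow> right q)"
  have peak: "peak B e scl act (vs ! p) \<longleftrightarrow> ?source p" if "p \<le> len" for p
    using peak_iff[OF that] remove1_mem_ideals_iff[OF that, of right] by blast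
  have valley: "valley B e scl act (vs ! p) \<longleftrightarrow> ?sink p" if "p \<le> len" for p
    using valley_iff[OF that] singleton_mem_ideals_iff[OF that, of right] by blast
  have mem: "p \<in> set ps \<longleftrightarrow> p \<le> len \<and> (?source p \<or> ?sink p)" for p
    unfolding set_ps using peak[of p] valley[of p] by (auto simp: length_vs less_Suc_eq_le)
  \<comment> \<open>An end of the string has at most one neighbour, so it is a source or a
    sink.\<close>
  have "0 \<in> set ps" by (subst mem) auto
  then obtain j where "j < length ps" "ps ! j = 0" by (auto simp: in_set_conv_nth)
  then have first: "ps ! 0 = 0" using sorted_nth_mono[OF sorted, of 0 j] by simp
  have "len \<in> set ps" by (subst mem) (cases len; auto)
  then obtain j where "j < length ps" "ps ! j = len" by (auto simp: in_set_conv_nth)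
  moreover have "ps ! length ks \<in> set ps" using length_ps by simp
  ultimately have last: "ps ! length ks = len"
    using sorted_nth_mono[OF sorted, of j "length ks"] mem length_ps by (intro antisym) auto
  \<comment> \<open>At an inner position, being a source or a sink means that the arrows on its two
    sides have different directions.\<close>
  have turn: "Suc p \<in> set ps \<longleftrightarrow> right (Suc p) \<noteq> right p" if "Suc p < len" for p
    using that by (subst mem) auto
  have dirs: "right p = (right 0 = even i)" if "i < length ks" "ps ! i \<le> p" "p < ps ! Suc i" for i p
  proof (cases "length vs = 1")
    case True
    then have "len = 0" using length_vs by simp
    moreover have "ps ! Suc i \<in> set ps" using that length_ps by simp
    ultimately show ?thesis using that(3) mem by auto
  next
    case False
    then show ?thesis using legs_alternate[OF sorted _ length_ps first last turn that] dist by auto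
  qed
  \<comment> \<open>The factors of \<open>N\<close> determine its set \<open>S\<close> of positions,
    and the length of \<open>N\<close> is \<open>card S\<close>. So it remains to count the
    positions of the leg that are not sources.\<close>
  have diff: "ks ! i = ps ! Suc i - ps ! i" if i: "i < length ks" for i
  proof -
    obtain N where N: "uniserial B scl act N" "{v \<in> verts Q. composition_factor e act N {0} v} =
             {vs ! p |p. ps ! i \<le> p \<and> p \<le> ps ! Suc i \<and> \<not> peak B e scl act (vs ! p)}"
      "has_composition_length B scl act N (ks ! i)" using legs i by blast
    obtain S where S: "S \<in> ideals right 0 len" "S \<subseteq> {0..len}" "N = position_span S"
      using N(1) unfolding uniserial_def by (blast elim: submoduleE)
    define a where "a = ps ! i"
    define c where "c = ps ! Suc i"
    have ac: "a \<in> set ps" "c \<in> set ps" "a \<le> c"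
      using i length_ps sorted_nth_mono[OF sorted, of i "Suc i"] unfolding a_def c_def by auto
    then have le: "a \<le> len" "c \<le> len" using mem by blast+
    have factors: "{v \<in> verts Q. composition_factor e act N {0} v} = (!) vs ` S"
    proof -
      have "(!) vs ` S \<subseteq> verts Q" using S(2) vs_mem by auto
      then show ?thesis unfolding S(3) using composition_factor_iff[OF S(2)] by blast
    qed
    have "{vs ! p |p. ps ! i \<le> p \<and> p \<le> ps ! Suc i \<and> \<not> peak B e scl act (vs ! p)} =
        (!) vs ` {p \<in> {a..c}. \<not> ?source p}"
      using peak le unfolding a_def c_def by fastforce
    then have "(!) vs ` S = (!) vs ` {p \<in> {a..c}. \<not> ?source p}" using N(2) factors by simp
    moreover have "inj_on ((!) vs) {0..len}" by (rule inj_onI) (simp add: vs_eq_iff)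
    moreover have "{p \<in> {a..c}. \<not> ?source p} \<subseteq> {0..len}" using le by auto
    ultimately have "S = {p \<in> {a..c}. \<not> ?source p}"
      using S(2) inj_on_image_eq_iff[of "(!) vs" "{0..len}" S "{p \<in> {a..c}. \<not> ?source p}"] by blast
    also have "card \<dots> = c - a"
    proof (cases "a = c")
      case True
      \<comment> \<open>Neighbours in \<open>ps\<close> coincide only for a simple module. Its
        single position is a source, so \<open>N\<close> is zero and the length is 0.\<close>
      then have "len = 0"
        using i dist length_ps length_vs nth_eq_iff_index_eq[of ps i "Suc i"]
        unfolding a_def c_def by (auto split: if_splits)
      then show ?thesis using True le by auto
    next
      case False
      then have lt: "a < c" using ac by simp
      have const: "right p = right a" if "a \<le> p" "p < c" for p
        using dirs[OF i, of p] dirs[OF i, of a] that lt unfolding a_def c_def by auto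
      \<comment> \<open>Exactly one position of the leg is a source: the left end if the leg points
        right, the right end otherwise. Either way \<open>c - a\<close> positions remain.\<close>
      have top: "{p \<in> {a..c}. \<not> P p} = {a<..c}"
        if "P a" "\<And>p. a < p \<Longrightarrow> p \<le> c \<Longrightarrow> \<not> P p" for P
        using that by (auto simp: le_less)
      have bot: "{p \<in> {a..c}. \<not> P p} = {a..<c}"
        if "P c" "\<And>p. a \<le> p \<Longrightarrow> p < c \<Longrightarrow> \<not> P p" for P
        using that by (auto simp: le_less)
      show ?thesis
      proof (cases "right a")
        case True
        have "?source a" using ac(1) mem[of a] True lt le by auto
        moreover have "\<not> ?source p" if "a < p" "p \<le> c" for p
          using const[of "p - 1"] that True by (cases p) auto
        ultimately have "{p \<in> {a..c}. \<not> ?source p} = {a<..c}" by (rule top)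
        then show ?thesis by simp
      next
        case False
        obtain c' where c': "c = Suc c'" using lt by (cases c) auto
        have "\<not> right c'" using const[of c'] lt False c' by auto
        then have "?source c" using ac(2) mem[of c] c' by auto
        moreover have "\<not> ?source p" if "a \<le> p" "p < c" for p
          using const[of p] that False le by auto
        ultimately have "{p \<in> {a..c}. \<not> ?source p} = {a..<c}" by (rule bot)
        then show ?thesis by simp
      qed
    qed
    finally show ?thesis
      using composition_length_eq_card[OF S(1)] N(3) S(3) unfolding a_def c_def by simp
  qed
  show ?thesis
    unfolding card_submodules
    by (rule card_ideals_legs[OF sorted length_ps first last diff dirs])
qed

end


section \<open>Idempotents in linear categories\<close>

lemma linear_category_Comp:
  assumes "linear_category C" "X \<in> Ob C" "Y \<in> Ob C" "Z \<in> Ob C" "g \<in> Hom C Y Z" "f \<in> Hom C X Y"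
  shows "Comp C X Y Z g f \<in> Hom C X Z"
  using assms unfolding linear_category_def by simp

lemma linear_category_assoc:
  assumes "linear_category C" "W \<in> Ob C" "X \<in> Ob C" "Y \<in> Ob C" "Z \<in> Ob C"
    and "h \<in> Hom C Y Z" "g \<in> Hom C X Y" "f \<in> Hom C W X"
  shows "Comp C W X Z (Comp C X Y Z h g) f = Comp C W Y Z h (Comp C W X Y g f)"
  using assms unfolding linear_category_def by simp

lemma linear_category_subspace:
  assumes "linear_category C" "X \<in> Ob C" "Y \<in> Ob C"
  shows "0 \<in> Hom C X Y" "f \<in> Hom C X Y \<Longrightarrow> g \<in> Hom C X Y \<Longrightarrow> f + g \<in> Hom C X Y"
    "f \<in> Hom C X Y \<Longrightarrow> Scl C c f \<in> Hom C X Y"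
proof -
  have "vector_space (Scl C)" and sub: "module.subspace (Scl C) (Hom C X Y)"
    using assms unfolding linear_category_def by simp_all
  then interpret vector_space "Scl C" by blast
  show "0 \<in> Hom C X Y" "f \<in> Hom C X Y \<Longrightarrow> g \<in> Hom C X Y \<Longrightarrow> f + g \<in> Hom C X Y"
    "f \<in> Hom C X Y \<Longrightarrow> Scl C c f \<in> Hom C X Y"
    using sub by (simp_all add: subspace_0 subspace_add subspace_scale)
qed

lemma linear_category_Comp_zero:
  assumes "linear_category C" "X \<in> Ob C" "Y \<in> Ob C" "Z \<in> Ob C"
  shows "f \<in> Hom C X Y \<Longrightarrow> Comp C X Y Z 0 f = 0" "g \<in> Hom C Y Z \<Longrightarrow> Comp C X Y Z g 0 = 0"
proof -
  have bilin: "Comp C X Y Z (g + g') f = Comp C X Y Z g f + Comp C X Y Z g' f \<and>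
      Comp C X Y Z g (f + f') = Comp C X Y Z g f + Comp C X Y Z g f'"
    if "g \<in> Hom C Y Z" "g' \<in> Hom C Y Z" "f \<in> Hom C X Y" "f' \<in> Hom C X Y" for g g' f f'
    using assms that unfolding linear_category_def by blast
  note zero = linear_category_subspace(1)[OF assms(1)]
  show "f \<in> Hom C X Y \<Longrightarrow> Comp C X Y Z 0 f = 0"
    using bilin[of 0 0 f f] zero assms by simp
  show "g \<in> Hom C Y Z \<Longrightarrow> Comp C X Y Z g 0 = 0"
    using bilin[of g g 0 0] zero assms by simp
qed

text \<open>By associativity, the product of two of these endomorphisms contains the factor
  \<open>prj i\<close> after \<open>inc j\<close>, which is an identity or 0.\<close>

lemma biproduct_idempotents:
  assumes lin: "linear_category C" and bip: "is_biproduct C J Ts T inc prj"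
  shows "i \<in> J \<Longrightarrow> summand_idempotent C T Ts inc prj i \<in> Hom C T T"
    and "i \<in> J \<Longrightarrow> j \<in> J \<Longrightarrow>
      Comp C T T T (summand_idempotent C T Ts inc prj i) (summand_idempotent C T Ts inc prj j) =
        (if i = j then summand_idempotent C T Ts inc prj i else 0)"
proof -
  have T: "T \<in> Ob C" and Ts: "\<And>i. i \<in> J \<Longrightarrow> Ts i \<in> Ob C"
    and inc: "\<And>i. i \<in> J \<Longrightarrow> inc i \<in> Hom C (Ts i) T"
    and prj: "\<And>i. i \<in> J \<Longrightarrow> prj i \<in> Hom C T (Ts i)"
    and orth: "\<And>i j. i \<in> J \<Longrightarrow> j \<in> J \<Longrightarrow>
        Comp C (Ts i) T (Ts j) (prj j) (inc i) = (if i = j then Id C (Ts i) else 0)"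
    using bip unfolding is_biproduct_def by blast+
  note comp = linear_category_Comp[OF lin] and assoc = linear_category_assoc[OF lin]
    and zero = linear_category_Comp_zero[OF lin]
  show mem: "summand_idempotent C T Ts inc prj i \<in> Hom C T T" if "i \<in> J" for i
    unfolding summand_idempotent_def using that by (intro comp T Ts inc prj)
  fix i j assume i: "i \<in> J" and j: "j \<in> J"
  let ?e = "summand_idempotent C T Ts inc prj"
  have "Comp C T T T (?e i) (?e j) = Comp C T (Ts i) T (inc i) (Comp C T T (Ts i) (prj i) (?e j))"
    unfolding summand_idempotent_def[of _ _ _ _ _ i]
    using i j by (intro assoc T Ts inc prj mem)
  also have "Comp C T T (Ts i) (prj i) (?e j) =
      Comp C T (Ts j) (Ts i) (Comp C (Ts j) T (Ts i) (prj i) (inc j)) (prj j)"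
    unfolding summand_idempotent_def using i j by (intro assoc[symmetric] T Ts inc prj)
  also have "\<dots> = (if i = j then prj i else 0)"
  proof (cases "i = j")
    case True
    have "Comp C T (Ts i) (Ts i) (Id C (Ts i)) (prj i) = prj i"
      using lin T Ts[OF i] prj[OF i] unfolding linear_category_def by simp
    then show ?thesis using True orth[OF i i] by simp
  next
    case False
    then show ?thesis using orth[OF j i] zero(1)[OF T Ts[OF j] Ts[OF i] prj[OF j]] by simp
  qed
  finally show "Comp C T T T (?e i) (?e j) = (if i = j then ?e i else 0)"
    using zero(2)[OF T Ts[OF i] T inc[OF i]] by (simp add: summand_idempotent_def)
qed

theorem theorem4p6:
  fixes n :: nat
    and C :: "('o, 'h::ab_group_add, 'k::field) tricat"
    and D :: "('d, 'e::ab_group_add, 'k) tricat"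
    and q :: "('k rep_cpx, 'k rep_cpx_mor, 'd, 'e) lfun"
    and \<tau> :: "('d, 'e, 'd, 'e) lfun"
    and F :: "int \<Rightarrow> ('d, 'e, 'd, 'e) lfun"
    and E :: "('d, int \<Rightarrow>\<^sub>0 'e, 'o, 'h) lfun"
    and T :: 'o and Ts :: "nat \<Rightarrow> 'o" and inc prj :: "nat \<Rightarrow> 'h"
    and B :: "('h, 'k) kalg" and e :: "nat \<Rightarrow> 'h"
    and Q :: "(nat, 'a) pre_digraph" and val :: "'a \<Rightarrow> 'h"
    and scl :: "'k \<Rightarrow> 'm::ab_group_add \<Rightarrow> 'm" and act :: "'h \<Rightarrow> 'm::ab_group_add \<Rightarrow> 'm"
    and ks :: "nat list" and m :: nat
  assumes "n \<ge> 1"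
    and "cluster_category_An n C D q \<tau> F E"
    and "cluster_tilting_object n C T Ts inc prj"
    and "B = End_alg C T"
    and "e = summand_idempotent C T Ts inc prj"
    and "verts Q = {1..n}"
    and "bound_quiver_presentation B Q e val"
    and "left_module B scl act"
    and "indecomposable_module B scl act"
    and "has_shape B Q e val scl act ks"
    and "m = length ks"
  shows "card {N. submodule B scl act N} =
         1 + (\<Sum>j=0..m. \<Sum>I | I \<subseteq> {1..m} \<and> card I = m - j \<and> admissible I.
                \<Prod>i\<in>I. ks ! (i - 1))"
proof -
  have lin: "linear_category C"
    using assms(2) unfolding cluster_category_An_def triangulated_category_def by blast
  have bip: "is_biproduct C {1..n} Ts T inc prj"
    using assms(3) unfolding cluster_tilting_object_def by blast
  then have T: "T \<in> Ob C" unfolding is_biproduct_def by blast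
  note idem = biproduct_idempotents[OF lin bip, folded assms(5,6)]
  have B: "acar B = Hom C T T" "amul B = Comp C T T T" "ascl B = Scl C"
    unfolding assms(4) End_alg_def by simp_all
  obtain vs as ps where shape: "is_string_module Q e val scl act vs as" "sorted ps"
    "if length vs = 1 then length ps = 2 else distinct ps"
    "set ps = {p. p < length vs \<and> (peak B e scl act (vs ! p) \<or> valley B e scl act (vs ! p))}"
    "length ps = Suc (length ks)"
    "\<forall>i<length ks. \<exists>N. uniserial B scl act N \<and>
       {v \<in> verts Q. composition_factor e act N {0} v} =
         {vs ! p |p. ps ! i \<le> p \<and> p \<le> ps ! Suc i \<and> \<not> peak B e scl act (vs ! p)} \<and>
       has_composition_length B scl act N (ks ! i)"
    using assms(10) unfolding has_shape_def by blast
  have string: "is_string Q vs as" using shape(1) unfolding is_string_module_def by blast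
  then have len: "length vs = Suc (length as)" unfolding is_string_def by blast
  then have range: "{..<length vs} = {0..length as}" by auto
  obtain x where basis: "inj_on x {..<length vs} \<and> \<not> module.dependent scl (x ` {..<length vs}) \<and>
        module.span scl (x ` {..<length vs}) = UNIV \<and>
        (\<forall>p<length vs. act (e (vs ! p)) (x p) = x p) \<and>
        (\<forall>a\<in>arcs Q. \<forall>p<length vs. act (val a) (x p) =
           (if Suc p < length vs \<and> as ! p = a \<and> tail Q a = vs ! p then x (Suc p)
            else if 0 < p \<and> as ! (p - 1) = a \<and> tail Q a = vs ! p then x (p - 1)
            else 0))"
    using shape(1)[unfolded is_string_module_def, THEN conjunct2] by (elim exE)
  have "vector_space scl" using assms(8) unfolding left_module_def by blast
  \<comment> \<open>\<open>Hom C T T\<close> is a subspace closed under composition, which gives the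
    closure assumptions on \<open>acar B\<close>. The unfolding of \<open>range\<close> and
    \<open>len\<close> replaces \<open>p < length vs\<close> by
    \<open>p \<le> length as\<close>.\<close>
  then interpret string_module scl B Q e val act vs as x
    unfolding string_module_def generated_module_def string_module_axioms_def generated_module_axioms_def B
    using linear_category_subspace[OF lin T T] linear_category_Comp[OF lin T T T] idem assms(6-8) string
      basis[unfolded range, unfolded len Suc_less_eq less_Suc_eq_le]
    by auto
  show ?thesis
    using card_submodules_of_shape[OF shape(2-6)] admissible_sum[OF assms(11)] by simp
qed

end
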